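(* Let $\boldsymbol{\eta}=\{\eta_n\}_{n=0}^\infty$ be a sequence of complex numbers. Then the following conditions are equivalent. (i) The Cesàro type operator $\mathcal{C}_{\boldsymbol{\eta}}$ is compact on the Dirichlet space $\mathcal{D}$. (ii) $\lim_{t\to1^-}\|\mathcal{C}_{\boldsymbol{\eta}}k_t\|_{\mathcal{D}}=0$, where $k_t$ is the normalized reproducing kernel of $\mathcal{D}$ at $t\in[0,1)$. (iii) $\displaystyle\sum_{n=m}^\infty n|\eta_n|^2=o\left(\frac{1}{\log(m+2)}\right)$ as $m\to\infty$.
   Context: $\mathbb{D}$ is the open unit disk, $H(\mathbb{D})$ is the space of analytic functions on $\mathbb{D}$, and $dA=\pi^{-1}dx\,dy$ is normalized Lebesgue measure on $\mathbb{D}$. The Dirichlet space $\mathcal{D}$ is the Hilbert space of $f\in H(\mathbb{D})$ with $\|f\|_{\mathcal{D}}^2=|f(0)|^2+\int_{\mathbb{D}}|f'(z)|^2dA(z)<\infty$. Its reproducing kernel at $w\in\mathbb{D}$ is $K_w(z)=1+\log\frac{1}{1-z\overline{w}}$, and the normalized reproducing kernel is $k_w(z)=K_w(z)/\sqrt{K_w(w)}$. For $f(z)=\sum_{n\ge0}a_nz^n\in H(\mathbb{D})$, the Cesàro type operator is $\mathcal{C}_{\boldsymbol{\eta}}(f)(z)=\sum_{n=0}^\infty\left(\eta_n\sum_{k=0}^na_k\right)z^n$, whenever the right-hand side makes sense and defines an analytic function in $\mathbb{D}$. It is compact on $\mathcal{D}$ if $\mathcal{C}_{\boldsymbol{\eta}}(f)$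 is well defined for every $f\in\mathcal{D}$ and $\mathcal{C}_{\boldsymbol{\eta}}$ is a compact linear operator from $\mathcal{D}$ to $\mathcal{D}$. In (ii), the norm is understood to be $+\infty$ if $\mathcal{C}_{\boldsymbol{\eta}}k_t$ is not a well-defined element of $\mathcal{D}$. *)

theory Defs
  imports "HOL-Complex_Analysis.Complex_Analysis" "HOL-Library.Landau_Symbols"
begin

text \<open>
  Functions on the open unit disk are represented by total functions of type
  \<^typ>\<open>complex \<Rightarrow> complex\<close> whose values outside the disk are irrelevant: none of the notions
  below looks at them.
\<close>

definition dirichlet_space :: "(complex \<Rightarrow> complex) set" where
  "dirichlet_space =
     {f. f holomorphic_on ball 0 1 \<and>
         set_integrable lborel (ball 0 1) (\<lambda>z. (cmod (deriv f z))\<^sup>2)}"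

text \<open>
  The factor \<^term>\<open>1 / pi\<close> turns Lebesgue measure into the normalized area measure \<open>dA\<close>. The
  value is meaningful for members of \<^const>\<open>dirichlet_space\<close> only.
\<close>

definition dirichlet_norm :: "(complex \<Rightarrow> complex) \<Rightarrow> real" where
  "dirichlet_norm f =
     sqrt ((cmod (f 0))\<^sup>2 + 1 / pi * (LINT z:ball 0 1|lborel. (cmod (deriv f z))\<^sup>2))"

definition dirichlet_kernel :: "complex \<Rightarrow> complex \<Rightarrow> complex" where
  "dirichlet_kernel w z = 1 + Ln (1 / (1 - z * cnj w))"

text \<open>
  For \<open>w\<close> in the disk, \<^term>\<open>dirichlet_kernel w w\<close> is a real number \<open>\<ge> 1\<close>, so \<^const>\<open>csqrt\<close> is
  its ordinary positive square root.
\<close>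

definition normalized_kernel :: "complex \<Rightarrow> complex \<Rightarrow> complex" where
  "normalized_kernel w z = dirichlet_kernel w z / csqrt (dirichlet_kernel w w)"

definition cesaro_coeff :: "(nat \<Rightarrow> complex) \<Rightarrow> (complex \<Rightarrow> complex) \<Rightarrow> nat \<Rightarrow> complex" where
  "cesaro_coeff \<eta> f n = \<eta> n * (\<Sum>k\<le>n. fps_nth (fps_expansion f 0) k)"

definition cesaro :: "(nat \<Rightarrow> complex) \<Rightarrow> (complex \<Rightarrow> complex) \<Rightarrow> complex \<Rightarrow> complex" where
  "cesaro \<eta> f z = (\<Sum>n. cesaro_coeff \<eta> f n * z ^ n)"

definition cesaro_well_defined :: "(nat \<Rightarrow> complex) \<Rightarrow> (complex \<Rightarrow> complex) \<Rightarrow> bool" where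
  "cesaro_well_defined \<eta> f \<longleftrightarrow>
     (\<forall>z\<in>ball 0 1. summable (\<lambda>n. cesaro_coeff \<eta> f n * z ^ n)) \<and>
     cesaro \<eta> f holomorphic_on ball 0 1"

definition cesaro_norm :: "(nat \<Rightarrow> complex) \<Rightarrow> (complex \<Rightarrow> complex) \<Rightarrow> ennreal" where
  "cesaro_norm \<eta> f =
     (if cesaro_well_defined \<eta> f \<and> cesaro \<eta> f \<in> dirichlet_space
      then ennreal (dirichlet_norm (cesaro \<eta> f)) else \<infinity>)"

definition dirichlet_linear :: "((complex \<Rightarrow> complex) \<Rightarrow> complex \<Rightarrow> complex) \<Rightarrow> bool" where
  "dirichlet_linear T \<longleftrightarrow>
     (\<forall>f\<in>dirichlet_space. T f \<in> dirichlet_space) \<and>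
     (\<forall>f\<in>dirichlet_space. \<forall>g\<in>dirichlet_space. \<forall>a b. \<forall>z\<in>ball 0 1.
        T (\<lambda>w. a * f w + b * g w) z = a * T f z + b * T g z)"

definition dirichlet_compact :: "((complex \<Rightarrow> complex) \<Rightarrow> complex \<Rightarrow> complex) \<Rightarrow> bool" where
  "dirichlet_compact T \<longleftrightarrow>
     dirichlet_linear T \<and>
     (\<forall>F :: nat \<Rightarrow> complex \<Rightarrow> complex. \<forall>B.
        (\<forall>n. F n \<in> dirichlet_space \<and> dirichlet_norm (F n) \<le> B) \<longrightarrow>
        (\<exists>g\<in>dirichlet_space. \<exists>r. strict_mono r \<and>
           (\<lambda>n. dirichlet_norm (\<lambda>z. T (F (r n)) z - g z)) \<longlonglongrightarrow> 0))"

definition cesaro_compact :: "(nat \<Rightarrow> complex) \<Rightarrow> bool" where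
  "cesaro_compact \<eta> \<longleftrightarrow>
     (\<forall>f\<in>dirichlet_space. cesaro_well_defined \<eta> f) \<and> dirichlet_compact (cesaro \<eta>)"

text \<open>
  The tail sum is required to converge, because \<^const>\<open>suminf\<close> carries no information about
  divergent series.
\<close>

definition tail_condition :: "(nat \<Rightarrow> complex) \<Rightarrow> bool" where
  "tail_condition \<eta> \<longleftrightarrow>
     summable (\<lambda>n. real n * (cmod (\<eta> n))\<^sup>2) \<and>
     (\<lambda>m. \<Sum>n. real (n + m) * (cmod (\<eta> (n + m)))\<^sup>2) \<in> o(\<lambda>m. 1 / ln (real m + 2))"

end

theory Submission
  imports Defs "HOL-Library.Diagonal_Subsequence"
begin

text \<open>
  In terms of Taylor coefficients the squared norm of the Dirichlet space is
  \<open>\<Sum> v\<^sub>n \<bar>a\<^sub>n\<bar>\<^sup>2\<close> with \<open>v\<^sub>0 = 1\<close> and \<open>v\<^sub>n = n\<close> otherwise, and that of the image under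
  the Cesaro operator is \<open>\<Sum> w\<^sub>n \<bar>a\<^sub>0 + \<dots> + a\<^sub>n\<bar>\<^sup>2\<close> with \<open>w\<^sub>n = v\<^sub>n \<bar>\<eta>\<^sub>n\<bar>\<^sup>2\<close>. By a weighted Hardy
  inequality their quotient is at most 4 times the supremum of \<open>W\<^sub>m V\<^sub>m\<close>, with \<open>W\<^sub>m\<close> the tail sum
  of \<open>w\<close> and \<open>V\<^sub>m\<close> the partial
  sum of \<open>1 / v\<close>, which is of order \<open>log m\<close>. Under (iii) the operator restricted to output
  coefficients of index at least \<open>M\<close> therefore has norm tending to 0, and a diagonal argument gives
  compactness. Under (i), the coefficients of the kernels \<open>k\<^sub>t\<close>, and hence those of their images,
  tend to 0, so 0 is the only possible limit of a subsequence of the images. For (ii) implies (iii), the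
  partial sums of index at least \<open>m\<close> of the coefficients of \<open>k\<^sub>t\<close> with \<open>t = 1 - 1 / (2 (m + 2))\<close> are
  at least a constant times \<open>sqrt (log (m + 2))\<close>.
\<close>

subsection \<open>Area integrals over disks\<close>

text \<open>Carries facts about linear maps of \<open>real^2\<close> over to the complex plane. A
  measure is determined by its values on boxes, and the preimage of a box is the box with the same
  corners.\<close>

lemma lborel_complex_eq_distr:
  "distr (lborel :: (real^2) measure) borel (\<lambda>v. Complex (vec_nth v 1) (vec_nth v 2)) = lborel"
proof (rule lborel_eqI[symmetric])
  have meas: "(\<lambda>v::real^2. Complex (vec_nth v 1) (vec_nth v 2)) \<in> borel_measurable borel"
    unfolding complex_eq by (intro borel_measurable_continuous_onI continuous_intros)
  fix l u :: complex assume le: "\<And>b. b \<in> Basis \<Longrightarrow> l \<bullet> b \<le> u \<bullet> b"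
  have vec: "(\<lambda>v::real^2. Complex (vec_nth v 1) (vec_nth v 2)) -` box l u
      = box (vector [Re l, Im l]) (vector [Re u, Im u])"
    by (auto simp: in_box_complex_iff mem_box_cart forall_2)
  have "\<forall>b\<in>Basis. (vector [Re l, Im l] :: real^2) \<bullet> b \<le> vector [Re u, Im u] \<bullet> b"
    using le[of 1] le[of \<i>] by (auto simp: Basis_vec_def inner_axis forall_2 Basis_complex_def)
  moreover have "(\<Prod>b\<in>(Basis :: (real^2) set). (vector [Re u, Im u] - vector [Re l, Im l]) \<bullet> b)
      = (Re u - Re l) * (Im u - Im l)"
    by (simp add: Basis_vec_def inner_axis UNIV_2 axis_eq_axis)
  ultimately show "emeasure (distr lborel borel (\<lambda>v::real^2. Complex (vec_nth v 1) (vec_nth v 2))) (box l u)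
      = ennreal (\<Prod>b\<in>Basis. (u - l) \<bullet> b)"
    using meas by (simp add: emeasure_distr vec emeasure_lborel_box_eq Basis_complex_def)
qed simp

text \<open>In the coordinates of \<open>real^2\<close>, multiplication by \<open>cnj w\<close> is
  the orthogonal map \<open>g\<close>, and orthogonal maps preserve volume. The conjugate enters
  because the preimage of a box under multiplication by \<open>w\<close> is measured.\<close>

lemma lborel_complex_rotate:
  fixes w :: complex
  assumes w: "cmod w = 1"
  shows "distr lborel borel (\<lambda>z. w * z) = lborel"
proof (rule lborel_eqI[symmetric])
  define \<phi> where "\<phi> v = Complex (vec_nth v 1) (vec_nth v 2)" for v :: "real^2"
  define \<psi> where "\<psi> z = (vector [Re z, Im z] :: real^2)" for z
  define g where "g v = \<psi> (cnj w * \<phi> v)" for v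
  have \<psi>\<phi> [simp]: "\<psi> (\<phi> v) = v" "\<phi> (\<psi> z) = z" for v z
    by (auto simp: \<psi>_def \<phi>_def vec_eq_iff forall_2)
  have meas: "\<phi> \<in> borel_measurable borel"
    unfolding \<phi>_def complex_eq by (intro borel_measurable_continuous_onI continuous_intros)
  have meas_w: "(\<lambda>z. w * z) \<in> borel_measurable borel"
    by (intro borel_measurable_continuous_onI continuous_intros)
  have w1: "w * cnj w = 1" using w by (simp add: complex_norm_square[symmetric])
  have gl: "linear g"
    by (rule linearI) (auto simp: g_def \<psi>_def \<phi>_def vec_eq_iff forall_2 algebra_simps)
  have n\<psi>: "norm (\<psi> z) = cmod z" for z
    by (simp add: \<psi>_def norm_vec_def L2_set_def UNIV_2 cmod_def)
  have "norm (g v) = norm v" for v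
    using n\<psi>[of "\<phi> v"] by (simp add: g_def n\<psi> norm_mult w)
  with gl have g: "orthogonal_transformation g"
    by (simp add: orthogonal_transformation)
  fix l u :: complex assume le: "\<And>b. b \<in> Basis \<Longrightarrow> l \<bullet> b \<le> u \<bullet> b"
  define S where "S = (\<lambda>z. w * z) -` box l u"
  have S: "S \<in> sets borel"
    using measurable_sets[OF meas_w, of "box l u"] by (simp add: S_def)
  define T where "T = \<phi> -` box l u"
  have T: "T \<in> sets borel"
    using measurable_sets[OF meas, of "box l u"] by (simp add: T_def)
  have eT: "emeasure lborel T = emeasure lborel (box l u)"
    using meas by (subst lborel_complex_eq_distr[symmetric])
      (simp add: emeasure_distr T_def \<phi>_def[abs_def])
  have "emeasure lborel (\<phi> -` S) = emeasure lborel S"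
    using emeasure_distr[of \<phi> "lborel :: (real^2) measure" borel S] meas S
    by (simp add: lborel_complex_eq_distr[folded \<phi>_def[abs_def]])
  have img: "\<phi> -` S = g ` T"
  proof (intro set_eqI iffI)
    fix v assume "v \<in> \<phi> -` S"
    then have "\<psi> (w * \<phi> v) \<in> T" "g (\<psi> (w * \<phi> v)) = v"
      using w1 by (auto simp: S_def T_def g_def mult.assoc[symmetric] mult.commute[of "cnj w"])
    then show "v \<in> g ` T" by force
  next
    fix v assume "v \<in> g ` T"
    then show "v \<in> \<phi> -` S"
      using w1 by (auto simp: S_def T_def g_def mult.assoc[symmetric])
  qed
  \<comment> \<open>\<open>measure_orthogonal_image\<close> compares real-valued measures; the
    finite measure of \<open>T\<close> allows the return to \<open>emeasure\<close>.\<close>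
  have Tm: "T \<in> lmeasurable"
    using T eT by (intro fmeasurableI) (auto simp: emeasure_lborel_box_eq)
  have "emeasure lborel S = emeasure lebesgue (g ` T)"
    using \<open>emeasure lborel (\<phi> -` S) = emeasure lborel S\<close> measurable_sets[OF meas, of S] S
    by (simp add: img)
  also have "\<dots> = emeasure lebesgue T"
    using measure_orthogonal_image[OF g Tm] measurable_orthogonal_image[OF g Tm] Tm
    by (simp add: emeasure_eq_measure2 fmeasurableD fmeasurableD2)
  also have "\<dots> = emeasure lborel (box l u)" using T eT by simp
  finally show "emeasure (distr lborel borel (\<lambda>z. w * z)) (box l u)
      = ennreal (\<Prod>b\<in>Basis. (u - l) \<bullet> b)"
    using meas_w le by (simp add: emeasure_distr S_def emeasure_lborel_box)
qed simp

section \<open>Integrals of monomials and power series over disks\<close>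

lemma set_integrable_continuous_ball:
  fixes f :: "complex \<Rightarrow> 'b::{banach,second_countable_topology}"
  assumes "continuous_on UNIV f"
  shows "set_integrable lborel (ball 0 r) f"
proof -
  have "set_integrable lborel (cball 0 r) f"
    unfolding set_integrable_def
    by (rule borel_integrable_compact) (use assms in \<open>auto intro: continuous_on_subset\<close>)
  then show ?thesis
    by (rule set_integrable_subset) auto
qed

text \<open>Rotation by the angle \<open>pi / (real n - real m)\<close> preserves disk and measure
  and multiplies the integrand by \<open>w ^ n * cnj w ^ m = -1\<close>, so the integral is its own
  negative.\<close>

lemma integral_monomials_orthogonal:
  assumes "n \<noteq> m"
  shows "(LINT z:ball 0 r|lborel. z ^ n * cnj z ^ m) = 0"
proof -
  define f where "f z = indicator (ball 0 r) z *\<^sub>R (z ^ n * cnj z ^ m)" for z :: complex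
  define w where "w = cis (pi / (real n - real m))"
  have w: "cmod w = 1" by (simp add: w_def)
  have "w ^ n * cnj w ^ m = cis (real n * (pi / (real n - real m)) - real m * (pi / (real n - real m)))"
    unfolding w_def cis_cnj Complex.DeMoivre cis_mult by simp
  also have "real n * (pi / (real n - real m)) - real m * (pi / (real n - real m)) = pi"
    using assms by (simp add: diff_divide_distrib[symmetric] left_diff_distrib[symmetric])
  finally have *: "w ^ n * cnj w ^ m = -1" by simp
  have f: "f \<in> borel_measurable borel"
    unfolding f_def by (intro borel_measurable_scaleR borel_measurable_indicator
       borel_measurable_continuous_onI continuous_intros) auto
  have "integral\<^sup>L lborel f = integral\<^sup>L (distr lborel borel (\<lambda>z. w * z)) f"
    using lborel_complex_rotate[OF w] by simp
  also have "\<dots> = (\<integral>z. f (w * z) \<partial>lborel)"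
    using f by (intro integral_distr) auto
  also have "\<dots> = (\<integral>z. - f z \<partial>lborel)"
  proof (intro Bochner_Integration.integral_cong refl)
    fix z
    have "(w * z) ^ n * cnj (w * z) ^ m = (w ^ n * cnj w ^ m) * (z ^ n * cnj z ^ m)"
      by (simp add: power_mult_distrib mult_ac)
    then show "f (w * z) = - f z"
      unfolding * by (simp add: f_def indicator_def norm_mult w)
  qed
  finally show ?thesis
    by (simp add: set_lebesgue_integral_def f_def[abs_def])
qed

text \<open>Dilation by \<open>r\<close> contributes the exponent \<open>2 * n\<close> through the
  integrand and 2 through the area.\<close>

lemma integral_norm_power_scale:
  assumes "r > 0"
  shows "(LINT z:ball 0 r|lborel. cmod z ^ (2 * n))
    = r ^ (2 * n + 2) * (LINT z:ball 0 1|lborel. cmod z ^ (2 * n))"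
proof -
  define f where "f s z = indicator (ball 0 s) z * cmod z ^ (2 * n)" for s and z :: complex
  have f: "f r \<in> borel_measurable borel"
    unfolding f_def by (intro borel_measurable_times borel_measurable_indicator
      borel_measurable_continuous_onI continuous_intros) auto
  have "integral\<^sup>L lborel (f r)
      = integral\<^sup>L (density (distr lborel borel (\<lambda>x. 0 + r *\<^sub>R x)) (\<lambda>_. \<bar>r\<bar> ^ DIM(complex))) (f r)"
    using lborel_affine[of r "0::complex"] assms by simp
  also have "\<dots> = (\<integral>z. r^2 * f r (r *\<^sub>R z) \<partial>lborel)"
    using f assms by (subst integral_density) (auto simp: integral_distr)
  also have "\<dots> = (\<integral>z. r ^ (2 * n + 2) * f 1 z \<partial>lborel)"
    using assms by (intro Bochner_Integration.integral_cong refl)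
      (auto simp: f_def indicator_def power_mult_distrib power_add power2_eq_square)
  finally show ?thesis
    by (simp add: set_lebesgue_integral_def f_def[abs_def])
qed

text \<open>
  Scaling determines the integral \<open>A\<close> up to its value: over the annulus \<open>x \<le> \<bar>z\<bar> < 1\<close> it equals
  \<open>A (1 - x ^ (2 n + 2))\<close>, which lies between \<open>x ^ (2 n)\<close> times the area and the area itself.
  Letting \<open>x\<close> tend to 1 gives \<open>A\<close>.
\<close>

lemma integral_norm_power_unit_disk:
  "(LINT z:ball 0 1|lborel. cmod z ^ (2 * n)) = pi / (real n + 1)"
proof -
  define A where "A = (LINT z:ball 0 1|lborel. cmod z ^ (2 * n))"
  have int: "set_integrable lborel (ball 0 r) (\<lambda>z. cmod z ^ (2 * n))" for r
    by (intro set_integrable_continuous_ball continuous_intros)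
  have bounds: "pi * x ^ (2 * n) \<le> A * (\<Sum>k\<le>n. (x\<^sup>2) ^ k)" "A * (\<Sum>k\<le>n. (x\<^sup>2) ^ k) \<le> pi"
    if x: "0 < x" "x < 1" for x
  proof -
    define R where "R = ball (0::complex) 1 - ball 0 x"
    have R: "R \<in> sets lborel" by (simp add: R_def)
    have intR: "set_integrable lborel R (\<lambda>z. cmod z ^ (2 * n))"
      by (rule set_integrable_subset[OF int[of 1]]) (auto simp: R_def)
    have area: "emeasure lborel (ball (0::complex) s) = ennreal (pi * s\<^sup>2)" if "s \<ge> 0" for s
      using that by (simp add: emeasure_ball unit_ball_vol_2)
    have "emeasure lborel R = ennreal pi - ennreal (pi * x\<^sup>2)"
      unfolding R_def using x by (subst emeasure_Diff) (auto simp: area)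
    then have eR: "emeasure lborel R = ennreal (pi * (1 - x\<^sup>2))"
      using x by (simp add: ennreal_minus algebra_simps)
    then have mR: "measure lborel R = pi * (1 - x\<^sup>2)"
      using x by (simp add: measure_def power_le_one)
    have fR: "emeasure lborel R < \<infinity>" using eR by simp
    have "A = (LINT z:ball 0 x|lborel. cmod z ^ (2 * n)) + (LINT z:R|lborel. cmod z ^ (2 * n))"
      unfolding A_def
      by (subst set_integral_Un[symmetric])
         (use x int intR in \<open>auto simp: R_def Un_absorb1 subset_ball intro!: arg_cong[where f="\<lambda>S. set_lebesgue_integral lborel S _"]\<close>)
    then have IR: "(LINT z:R|lborel. cmod z ^ (2 * n)) = A * (1 - (x\<^sup>2) ^ (n + 1))"
      using integral_norm_power_scale[OF x(1), of n]
      by (simp add: A_def algebra_simps power_mult[symmetric] power2_eq_square flip: power_add mult_2_right)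
    \<comment> \<open>Both bounds carry the factor \<open>1 - x\<^sup>2\<close>, which vanishes in
      the limit. This factorization lets it cancel and leaves a geometric sum that tends to
      \<open>n + 1\<close>.\<close>
    have geo: "1 - (x\<^sup>2) ^ (n + 1) = (1 - x\<^sup>2) * (\<Sum>k\<le>n. (x\<^sup>2) ^ k)"
      using one_diff_power_eq[of "x\<^sup>2" "n+1"] by (simp add: lessThan_Suc_atMost)
    have cI: "set_integrable lborel R (\<lambda>z. c)" for c :: real
      using fR R by (simp add: set_integrable_def)
    have "(LINT z:R|lborel. x ^ (2 * n)) \<le> (LINT z:R|lborel. cmod z ^ (2 * n))"
      using x intR cI by (intro set_integral_mono) (auto simp: R_def intro!: power_mono)
    then have 1: "x ^ (2 * n) * (pi * (1 - x\<^sup>2)) \<le> A * (1 - (x\<^sup>2) ^ (n + 1))"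
      using fR R unfolding IR[symmetric] mR[symmetric]
      by (simp add: set_lebesgue_integral_def mult.commute)
    have "(LINT z:R|lborel. cmod z ^ (2 * n)) \<le> (LINT z:R|lborel. 1)"
      using x intR cI by (intro set_integral_mono) (auto simp: R_def intro!: power_le_one)
    then have 2: "A * (1 - (x\<^sup>2) ^ (n + 1)) \<le> pi * (1 - x\<^sup>2)"
      using fR R unfolding IR[symmetric] mR[symmetric] by (simp add: set_lebesgue_integral_def)
    have pos: "1 - x\<^sup>2 > 0" using x by (simp add: power_less_one_iff abs_square_less_1)
    show "pi * x ^ (2 * n) \<le> A * (\<Sum>k\<le>n. (x\<^sup>2) ^ k)"
      using 1 pos unfolding geo by (simp add: mult_ac)
    show "A * (\<Sum>k\<le>n. (x\<^sup>2) ^ k) \<le> pi"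
      using 2 pos unfolding geo by (simp add: mult_ac)
  qed
  have ev: "eventually (\<lambda>x::real. 0 < x \<and> x < 1) (at_left 1)"
    using eventually_at_left_real[of 0 1] by (auto elim: eventually_mono)
  have lim: "((\<lambda>x. A * (\<Sum>k\<le>n. (x\<^sup>2) ^ k)) \<longlongrightarrow> A * (\<Sum>k\<le>n. (1\<^sup>2) ^ k)) (at_left (1::real))"
    by (intro tendsto_intros)
  have lim': "((\<lambda>x. pi * x ^ (2 * n)) \<longlongrightarrow> pi * 1 ^ (2 * n)) (at_left (1::real))"
    by (intro tendsto_intros)
  have "A * (\<Sum>k\<le>n. (1\<^sup>2) ^ k) \<le> pi"
    by (rule tendsto_upperbound[OF lim]) (use ev bounds in \<open>auto elim!: eventually_mono\<close>)
  moreover have "pi * 1 ^ (2 * n) \<le> A * (\<Sum>k\<le>n. (1\<^sup>2) ^ k)"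
    by (rule tendsto_le[OF _ lim lim']) (use ev bounds in \<open>auto elim!: eventually_mono\<close>)
  ultimately have "A * (real n + 1) = pi" by (simp add: algebra_simps)
  then show ?thesis by (simp add: A_def field_simps)
qed

text \<open>The squared modulus expands into a double sum of monomials in \<open>z\<close> and
  \<open>cnj z\<close>, of which orthogonality leaves the diagonal.\<close>

lemma set_integral_norm_polynomial:
  fixes c :: "nat \<Rightarrow> complex"
  assumes r: "r > 0"
  shows "(LINT z:ball 0 r|lborel. (cmod (\<Sum>k<N. c k * z ^ k))\<^sup>2)
     = (\<Sum>k<N. (cmod (c k))\<^sup>2 * (pi * r ^ (2 * k + 2) / (real k + 1)))"
proof -
  let ?D = "ball (0::complex) r"
  define J where "J k l = (LINT z:?D|lborel. z ^ k * cnj z ^ l)" for k l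
  have int: "set_integrable lborel ?D (\<lambda>z. z ^ k * cnj z ^ l)" for k l
    by (intro set_integrable_continuous_ball continuous_intros)
  have J: "J k l = (if k = l then complex_of_real (pi * r ^ (2 * k + 2) / (real k + 1)) else 0)" for k l
  proof (cases "k = l")
    case True
    have "J k k = (LINT z:?D|lborel. complex_of_real (cmod z ^ (2 * k)))"
      unfolding J_def by (simp add: power_mult_distrib[symmetric] complex_norm_square[symmetric] power_mult)
    also have "\<dots> = complex_of_real (LINT z:?D|lborel. cmod z ^ (2 * k))"
      by (rule set_integral_complex_of_real)
    finally show ?thesis
      using True integral_norm_power_scale[OF r, of k] by (simp add: integral_norm_power_unit_disk)
  qed (simp add: J_def integral_monomials_orthogonal)
  have "complex_of_real (LINT z:?D|lborel. (cmod (\<Sum>k<N. c k * z ^ k))\<^sup>2)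
      = (LINT z:?D|lborel. complex_of_real ((cmod (\<Sum>k<N. c k * z ^ k))\<^sup>2))"
    by (rule set_integral_complex_of_real[symmetric])
  also have "\<dots> = (LINT z:?D|lborel. (\<Sum>k<N. \<Sum>l<N. c k * cnj (c l) * (z ^ k * cnj z ^ l)))"
    by (simp only: complex_norm_square cnj_sum complex_cnj_mult complex_cnj_power sum_product mult_ac)
  also have "\<dots> = (\<Sum>k<N. \<Sum>l<N. c k * cnj (c l) * J k l)"
  proof -
    define m where "m k l z = indicator ?D z *\<^sub>R (z ^ k * cnj z ^ l)" for k l and z :: complex
    have m: "integrable lborel (m k l)" for k l
      using int[of k l] by (simp add: set_integrable_def m_def[abs_def])
    have "(LINT z:?D|lborel. (\<Sum>k<N. \<Sum>l<N. c k * cnj (c l) * (z ^ k * cnj z ^ l)))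
        = (\<integral>z. (\<Sum>k<N. \<Sum>l<N. c k * cnj (c l) * m k l z) \<partial>lborel)"
      unfolding set_lebesgue_integral_def m_def by (simp only: scaleR_sum_right mult_scaleR_right)
    also have "\<dots> = (\<Sum>k<N. \<Sum>l<N. c k * cnj (c l) * (\<integral>z. m k l z \<partial>lborel))"
      using m by simp
    finally show ?thesis by (simp add: J_def set_lebesgue_integral_def m_def)
  qed
  also have "\<dots> = (\<Sum>k<N. c k * cnj (c k) * complex_of_real (pi * r ^ (2 * k + 2) / (real k + 1)))"
    by (simp add: J if_distrib[of "(*) _"] sum.delta cong: if_cong)
  also have "\<dots> = complex_of_real (\<Sum>k<N. (cmod (c k))\<^sup>2 * (pi * r ^ (2 * k + 2) / (real k + 1)))"
    by (simp only: complex_norm_square of_real_sum of_real_mult)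
  finally show ?thesis by (simp only: of_real_eq_iff)
qed

text \<open>Absolute convergence at radius \<open>r\<close> bounds all partial sums by the constant
  \<open>M\<close> on the disk, so dominated convergence extends the polynomial case. It is applied
  to radii below 1 only.\<close>

lemma set_integral_norm_power_series:
  fixes c :: "nat \<Rightarrow> complex"
  assumes r: "r > 0" and abs: "summable (\<lambda>k. cmod (c k) * r ^ k)"
    and g: "\<And>z. z \<in> ball 0 r \<Longrightarrow> (\<lambda>k. c k * z ^ k) sums g z"
  shows "set_integrable lborel (ball 0 r) (\<lambda>z. (cmod (g z))\<^sup>2)" (is ?I)
    and "(\<lambda>k. (cmod (c k))\<^sup>2 * (pi * r ^ (2 * k + 2) / (real k + 1)))
      sums (LINT z:ball 0 r|lborel. (cmod (g z))\<^sup>2)" (is ?S)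
proof -
  let ?D = "ball (0::complex) r"
  define M where "M = (\<Sum>k. cmod (c k) * r ^ k)"
  define p where "p N z = (\<Sum>k<N. c k * z ^ k)" for N z
  define s where "s N z = indicator ?D z *\<^sub>R (cmod (p N z))\<^sup>2" for N z
  define f where "f z = indicator ?D z *\<^sub>R (cmod (g z))\<^sup>2" for z
  have pM: "cmod (p N z) \<le> M" if "z \<in> ?D" for N z
  proof -
    have "cmod (p N z) \<le> (\<Sum>k<N. cmod (c k) * r ^ k)"
      unfolding p_def using that
      by (intro sum_norm_le) (auto simp: norm_mult norm_power intro!: mult_left_mono power_mono)
    also have "\<dots> \<le> M"
      unfolding M_def using r by (intro sum_le_suminf abs) auto
    finally show ?thesis .
  qed
  have lim: "(\<lambda>N. s N z) \<longlonglongrightarrow> f z" for z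
  proof (cases "z \<in> ?D")
    case True
    then have "(\<lambda>N. p N z) \<longlonglongrightarrow> g z" using g by (simp add: sums_def p_def)
    then have "(\<lambda>N. (cmod (p N z))\<^sup>2) \<longlonglongrightarrow> (cmod (g z))\<^sup>2" by (intro tendsto_intros)
    with True show ?thesis by (simp add: s_def f_def)
  qed (simp add: s_def f_def)
  have ms: "s N \<in> borel_measurable lborel" for N
    unfolding s_def p_def by (intro borel_measurable_scaleR borel_measurable_indicator
       borel_measurable_continuous_onI continuous_intros) auto
  have mf: "f \<in> borel_measurable lborel"
    by (rule borel_measurable_LIMSEQ_real[OF lim ms])
  have w: "integrable lborel (\<lambda>z. indicator ?D z *\<^sub>R M\<^sup>2)"
    using set_integrable_continuous_ball[of "\<lambda>_. M\<^sup>2" r] by (simp add: set_integrable_def)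
  have bd: "norm (s N z) \<le> indicator ?D z *\<^sub>R M\<^sup>2" for N z
    using pM[of z N] by (auto simp: s_def indicator_def intro!: power_mono)
  have "integrable lborel f"
    by (rule integrable_dominated_convergence[where s=s, OF mf ms w]) (use lim bd in auto)
  then show ?I by (simp add: set_integrable_def f_def[abs_def])
  have "(\<lambda>N. integral\<^sup>L lborel (s N)) \<longlonglongrightarrow> integral\<^sup>L lborel f"
    by (rule integral_dominated_convergence[OF mf ms w]) (use lim bd in auto)
  moreover have "integral\<^sup>L lborel (s N) = (\<Sum>k<N. (cmod (c k))\<^sup>2 * (pi * r ^ (2 * k + 2) / (real k + 1)))" for N
    using set_integral_norm_polynomial[OF r, where c=c and N=N]
    by (simp add: s_def[abs_def] set_lebesgue_integral_def p_def)
  ultimately show ?S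
    by (simp add: sums_def set_lebesgue_integral_def f_def[abs_def])
qed

subsection \<open>Taylor coefficients and the Dirichlet norm\<close>

abbreviation taylor_coeff :: "(complex \<Rightarrow> complex) \<Rightarrow> nat \<Rightarrow> complex" where
  "taylor_coeff f n \<equiv> fps_nth (fps_expansion f 0) n"

lemma taylor_sums:
  assumes "f holomorphic_on ball 0 1" "cmod z < 1"
  shows "(\<lambda>n. taylor_coeff f n * z ^ n) sums f z"
  using assms has_fps_expansion_imp_sums_complex[OF has_fps_expansion_fps_expansion, of "ball 0 1" f 1 z]
  by (simp add: one_ereal_def)

lemma taylor_abs_summable:
  assumes "f holomorphic_on ball 0 1" "0 \<le> r" "r < 1"
  shows "summable (\<lambda>n. cmod (taylor_coeff f n) * r ^ n)"
proof -
  have "1 \<le> fps_conv_radius (fps_expansion f 0)"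
    using assms conv_radius_fps_expansion[of f 0 1] by (simp add: one_ereal_def)
  moreover have "ereal (cmod (of_real r)) < 1" using assms by simp
  ultimately have "ereal (cmod (of_real r)) < fps_conv_radius (fps_expansion f 0)" by order
  from abs_summable_in_conv_radius[OF this[unfolded fps_conv_radius_def]] show ?thesis
    using assms by (simp add: norm_mult norm_power)
qed

lemma taylor_coeff_deriv:
  "taylor_coeff (deriv f) n = of_nat (Suc n) * taylor_coeff f (Suc n)"
  by (simp add: fps_expansion_def funpow_Suc_right del: funpow.simps of_nat_Suc)

text \<open>Convergence throughout the disk makes the radius of convergence at least 1, so
  \<open>Abs_fps b\<close> is the expansion of \<open>f\<close> at 0. Coefficients of functions
  given by a series are read off in this way.\<close>

lemma taylor_coeff_unique:
  assumes f: "\<And>z. z \<in> ball 0 1 \<Longrightarrow> (\<lambda>n. b n * z ^ n) sums f z"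
  shows "f holomorphic_on ball 0 1" and "taylor_coeff f = b"
proof -
  show hol: "f holomorphic_on ball 0 1"
    by (rule power_series_holomorphic[of 0 1 b]) (use f in auto)
  have "f has_fps_expansion Abs_fps b"
  proof -
    have "conv_radius b \<ge> 1"
    proof (rule conv_radius_geI_ex')
      fix r :: real assume "0 < r" "ereal r < 1"
      then show "summable (\<lambda>n. b n * complex_of_real r ^ n)"
        using f[of "of_real r"] by (auto simp: sums_iff)
    qed
    then have "fps_conv_radius (Abs_fps b) > 0"
      by (simp add: fps_conv_radius_def less_le_trans[of 0 1])
    moreover have "eventually (\<lambda>z. z \<in> ball 0 1) (nhds (0::complex))"
      by (intro eventually_nhds_in_open) auto
    then have "eventually (\<lambda>z. eval_fps (Abs_fps b) z = f z) (nhds 0)"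
      by eventually_elim (use f in \<open>auto simp: eval_fps_def sums_iff\<close>)
    ultimately show ?thesis by (simp add: has_fps_expansion_def)
  qed
  then show "taylor_coeff f = b"
    by (simp add: fps_expansion_eqI fun_eq_iff)
qed

text \<open>Formulated in \<open>ennreal\<close> so that infinite values are covered and membership
  as well as norm can be deduced. On disks of radius \<open>\<rho> i < 1\<close> the series of the
  derivative converges absolutely; monotone convergence then passes to radius 1.\<close>

lemma nn_integral_norm_deriv:
  assumes f: "f holomorphic_on ball 0 1"
  shows "(\<integral>\<^sup>+z. ennreal (indicator (ball 0 1) z * (cmod (deriv f z))\<^sup>2) \<partial>lborel)
    = (\<Sum>n. ennreal (pi * (real n * (cmod (taylor_coeff f n))\<^sup>2)))"
proof -
  define \<rho> where "\<rho> i = 1 - 1 / (real i + 2)" for i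
  have \<rho>: "0 < \<rho> i" "\<rho> i < 1" for i by (auto simp: \<rho>_def field_simps)
  have \<rho>_mono: "\<rho> i \<le> \<rho> j" if "i \<le> j" for i j
    using that by (auto simp: \<rho>_def frac_le)
  have \<rho>_lim: "\<rho> \<longlonglongrightarrow> 1"
    unfolding \<rho>_def by real_asymp
  define a where "a n = (cmod (taylor_coeff f n))\<^sup>2" for n
  have df: "deriv f holomorphic_on ball 0 1"
    using f by (intro holomorphic_deriv) auto
  define F where "F i z = ennreal (indicator (ball 0 (\<rho> i)) z * (cmod (deriv f z))\<^sup>2)" for i z
  define G where "G i n = ennreal (pi * (real n * a n) * \<rho> i ^ (2 * n))" for i n
  have int_i: "set_integrable lborel (ball 0 (\<rho> i)) (\<lambda>z. (cmod (deriv f z))\<^sup>2)"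
    and sums_i: "(\<lambda>k. (cmod (taylor_coeff (deriv f) k))\<^sup>2 * (pi * \<rho> i ^ (2 * k + 2) / (real k + 1)))
       sums (LINT z:ball 0 (\<rho> i)|lborel. (cmod (deriv f z))\<^sup>2)" for i
    using \<rho>[of i] df
    by (intro set_integral_norm_power_series[where c="taylor_coeff (deriv f)"] taylor_abs_summable
         taylor_sums; simp)+
  \<comment> \<open>Reading the series as an integral over counting measure lets one monotone
    convergence theorem serve both sides.\<close>
  have eq_i: "integral\<^sup>N lborel (F i) = integral\<^sup>N (count_space UNIV) (G i)" for i
  proof -
    have term_eq: "(cmod (taylor_coeff (deriv f) k))\<^sup>2 * (pi * \<rho> i ^ (2 * k + 2) / (real k + 1))
        = pi * (real (Suc k) * a (Suc k)) * \<rho> i ^ (2 * Suc k)" for k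
      unfolding taylor_coeff_deriv a_def norm_mult norm_of_nat
      by (simp add: power_mult_distrib power2_eq_square divide_simps)
    have "(\<lambda>k. pi * (real (Suc k) * a (Suc k)) * \<rho> i ^ (2 * Suc k))
       sums (LINT z:ball 0 (\<rho> i)|lborel. (cmod (deriv f z))\<^sup>2)"
      using sums_i[of i] by (simp only: term_eq)
    \<comment> \<open>The term at 0 vanishes, so the index shift caused by differentiation can be
      undone.\<close>
    then have *: "(\<lambda>n. pi * (real n * a n) * \<rho> i ^ (2 * n))
       sums (LINT z:ball 0 (\<rho> i)|lborel. (cmod (deriv f z))\<^sup>2)"
      by (subst (asm) sums_Suc_iff) simp
    have "integral\<^sup>N lborel (F i) = ennreal (LINT z:ball 0 (\<rho> i)|lborel. (cmod (deriv f z))\<^sup>2)"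
      using int_i[of i] unfolding F_def set_lebesgue_integral_def set_integrable_def
      by (subst nn_integral_eq_integral) auto
    also have "\<dots> = (\<Sum>n. G i n)"
      unfolding G_def using * \<rho>[of i]
      by (subst suminf_ennreal2) (auto simp: sums_iff a_def intro!: mult_nonneg_nonneg)
    finally show ?thesis by (simp add: nn_integral_count_space_nat)
  qed
  have mF: "F i \<in> borel_measurable lborel" for i
  proof -
    have "(\<lambda>z. indicator (ball 0 (\<rho> i)) z *\<^sub>R (cmod (deriv f z))\<^sup>2) \<in> borel_measurable lborel"
      using int_i[of i] unfolding set_integrable_def by (rule borel_measurable_integrable)
    then show ?thesis unfolding F_def by simp
  qed
  have "(\<lambda>i. integral\<^sup>N lborel (F i)) \<longlonglongrightarrow>
      (\<integral>\<^sup>+z. ennreal (indicator (ball 0 1) z * (cmod (deriv f z))\<^sup>2) \<partial>lborel)"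
  proof (rule nn_integral_LIMSEQ)
    show "incseq F"
      using \<rho>_mono by (force simp: incseq_def le_fun_def F_def indicator_def intro!: ennreal_leI)
    fix z :: complex
    have "eventually (\<lambda>i. F i z = ennreal (indicator (ball 0 1) z * (cmod (deriv f z))\<^sup>2)) sequentially"
    proof (cases "cmod z < 1")
      case True
      have "eventually (\<lambda>i. cmod z < \<rho> i) sequentially"
        using order_tendstoD(1)[OF \<rho>_lim True] .
      then show ?thesis by eventually_elim (use True in \<open>simp add: F_def\<close>)
    next
      case False
      then have "\<not> cmod z < \<rho> i" for i using \<rho>(2)[of i] by linarith
      with False show ?thesis by (simp add: F_def)
    qed
    then show "(\<lambda>i. F i z) \<longlonglongrightarrow> ennreal (indicator (ball 0 1) z * (cmod (deriv f z))\<^sup>2)"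
      by (rule tendsto_eventually)
  qed (rule mF)
  moreover have "(\<lambda>i. integral\<^sup>N (count_space UNIV) (G i)) \<longlonglongrightarrow>
      (\<integral>\<^sup>+n. ennreal (pi * (real n * a n)) \<partial>count_space UNIV)"
  proof (rule nn_integral_LIMSEQ)
    show "incseq G"
      using \<rho>_mono \<rho> unfolding incseq_def le_fun_def G_def
      by (auto simp: a_def less_imp_le intro!: ennreal_leI mult_left_mono power_mono)
    fix n
    have "(\<lambda>i. pi * (real n * a n) * \<rho> i ^ (2 * n)) \<longlonglongrightarrow> pi * (real n * a n) * 1 ^ (2 * n)"
      by (intro tendsto_intros \<rho>_lim)
    then show "(\<lambda>i. G i n) \<longlonglongrightarrow> ennreal (pi * (real n * a n))"
      unfolding G_def by (intro tendsto_ennrealI) simp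
  qed simp
  ultimately show ?thesis
    unfolding eq_i nn_integral_count_space_nat a_def by (rule LIMSEQ_unique)
qed

lemma dirichlet_space_iff:
  assumes f: "f holomorphic_on ball 0 1"
  shows "f \<in> dirichlet_space \<longleftrightarrow> summable (\<lambda>n. real n * (cmod (taylor_coeff f n))\<^sup>2)"
proof -
  define c where "c n = real n * (cmod (taylor_coeff f n))\<^sup>2" for n
  have c0: "c n \<ge> 0" for n by (simp add: c_def)
  define h where "h z = indicator (ball 0 1) z * (cmod (deriv f z))\<^sup>2" for z
  have "deriv f holomorphic_on ball 0 1"
    using f by (intro holomorphic_deriv) auto
  then have "continuous_on (ball 0 1) (\<lambda>z. (cmod (deriv f z))\<^sup>2)"
    by (intro continuous_intros holomorphic_on_imp_continuous_on)
  then have mh: "h \<in> borel_measurable lborel"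
    unfolding h_def
    using borel_measurable_continuous_on_indicator[of "ball 0 1" "\<lambda>z. (cmod (deriv f z))\<^sup>2"] by simp
  have "f \<in> dirichlet_space \<longleftrightarrow> integrable lborel h"
    using f by (simp add: dirichlet_space_def set_integrable_def h_def[abs_def])
  also have "\<dots> \<longleftrightarrow> (\<integral>\<^sup>+z. ennreal (h z) \<partial>lborel) < \<infinity>"
    using mh by (simp add: integrable_iff_bounded h_def)
  also have "\<dots> \<longleftrightarrow> (\<Sum>n. ennreal (pi * c n)) < \<infinity>"
    using nn_integral_norm_deriv[OF f] by (simp add: h_def c_def)
  also have "\<dots> \<longleftrightarrow> summable (\<lambda>n. pi * c n)"
  proof
    assume "(\<Sum>n. ennreal (pi * c n)) < \<infinity>"
    then show "summable (\<lambda>n. pi * c n)"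
      by (intro summable_suminf_not_top) (auto simp: c0)
  next
    assume "summable (\<lambda>n. pi * c n)"
    then show "(\<Sum>n. ennreal (pi * c n)) < \<infinity>"
      by (subst suminf_ennreal2) (auto simp: c0)
  qed
  also have "\<dots> \<longleftrightarrow> summable c"
    by (simp add: summable_cmult_iff)
  finally show ?thesis by (simp add: c_def[abs_def])
qed

lemma dirichlet_norm_eq:
  assumes f: "f \<in> dirichlet_space"
  shows "(dirichlet_norm f)\<^sup>2
    = (cmod (taylor_coeff f 0))\<^sup>2 + (\<Sum>n. real n * (cmod (taylor_coeff f n))\<^sup>2)"
proof -
  have hol: "f holomorphic_on ball 0 1"
    and int: "integrable lborel (\<lambda>z. indicator (ball 0 1) z *\<^sub>R (cmod (deriv f z))\<^sup>2)"
    using f by (auto simp: dirichlet_space_def set_integrable_def)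
  define c where "c n = real n * (cmod (taylor_coeff f n))\<^sup>2" for n
  have c0: "c n \<ge> 0" for n by (simp add: c_def)
  have sc: "summable c" using f dirichlet_space_iff[OF hol] by (simp add: c_def[abs_def])
  have "ennreal (LINT z:ball 0 1|lborel. (cmod (deriv f z))\<^sup>2) = ennreal (pi * suminf c)"
  proof -
    have "ennreal (LINT z:ball 0 1|lborel. (cmod (deriv f z))\<^sup>2)
       = (\<integral>\<^sup>+z. ennreal (indicator (ball 0 1) z * (cmod (deriv f z))\<^sup>2) \<partial>lborel)"
      using int unfolding set_lebesgue_integral_def by (subst nn_integral_eq_integral[symmetric]) auto
    also have "\<dots> = (\<Sum>n. ennreal (pi * c n))"
      unfolding c_def by (rule nn_integral_norm_deriv[OF hol])
    also have "\<dots> = ennreal (pi * suminf c)"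
      using sc c0 by (subst suminf_ennreal2) (auto simp: suminf_mult)
    finally show ?thesis .
  qed
  moreover have "0 \<le> (LINT z:ball 0 1|lborel. (cmod (deriv f z))\<^sup>2)"
    unfolding set_lebesgue_integral_def by (intro Bochner_Integration.integral_nonneg) simp
  moreover have "0 \<le> suminf c" using sc c0 by (simp add: suminf_nonneg)
  ultimately have "(LINT z:ball 0 1|lborel. (cmod (deriv f z))\<^sup>2) = pi * suminf c" by simp
  moreover have "taylor_coeff f 0 = f 0" by (simp add: fps_expansion_def)
  ultimately show ?thesis
    using \<open>0 \<le> suminf c\<close> by (simp add: dirichlet_norm_def c_def[abs_def])
qed

subsection \<open>A weighted Hardy inequality\<close>

text \<open>The discrete counterpart of the fact that \<open>2 * sqrt b\<close> is an antiderivative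
  of \<open>1 / sqrt b\<close>. It turns quotients of increments by square roots into telescoping
  differences.\<close>

lemma diff_div_sqrt_le:
  fixes a b :: real
  assumes "0 \<le> a" "a \<le> b"
  shows "(b - a) / sqrt b \<le> 2 * (sqrt b - sqrt a)"
\<comment> \<open>For \<open>b = 0\<close> also \<open>a = 0\<close>, and division by zero yields 0
  on the left.\<close>
proof (cases "b = 0")
  case False
  then have b: "b > 0" using assms by simp
  have "b - a = (sqrt b - sqrt a) * (sqrt b + sqrt a)"
    using assms by (simp add: algebra_simps)
  also have "\<dots> \<le> (sqrt b - sqrt a) * (2 * sqrt b)"
    using assms by (intro mult_left_mono) auto
  finally show ?thesis using b by (simp add: field_simps)
qed (use assms in auto)

text \<open>
  After Cauchy--Schwarz with the extra weight \<open>sqrt (V k)\<close> and an exchange of summations,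
  \<open>diff_div_sqrt_le\<close> bounds both inner sums by telescoping ones.
\<close>

lemma weighted_hardy:
  fixes x v W :: "nat \<Rightarrow> real"
  defines "V \<equiv> \<lambda>n. \<Sum>k\<le>n. 1 / v k"
  assumes v: "\<And>k. v k > 0" and x: "\<And>k. x k \<ge> 0"
    and W0: "\<And>n. W n \<ge> 0" and W: "\<And>n. W (Suc n) \<le> W n"
    and B: "\<And>n. W n * V n \<le> B"
  shows "(\<Sum>n<N. (W n - W (Suc n)) * (\<Sum>k\<le>n. x k)\<^sup>2) \<le> 4 * B * (\<Sum>k<N. v k * (x k)\<^sup>2)"
proof -
  have V0: "V n > 0" for n unfolding V_def using v by (intro sum_pos) auto
  have B0: "B \<ge> 0" using B[of 0] W0[of 0] V0[of 0] by (smt (verit) mult_nonneg_nonneg)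
  define h where "h k = v k * sqrt (V k)" for k
  have h0: "h k > 0" for k using v V0 by (simp add: h_def)
  have inv_h: "(\<Sum>k\<le>n. 1 / h k) \<le> 2 * sqrt (V n)" for n
  proof (induction n)
    case 0
    have "1 / h 0 = V 0 / sqrt (V 0)" by (simp add: h_def V_def)
    also have "\<dots> = sqrt (V 0)" using V0[of 0] by (simp add: real_div_sqrt)
    finally have "1 / h 0 = sqrt (V 0)" .
    then show ?case using V0[of 0] by simp
  next
    case (Suc n)
    \<comment> \<open>\<open>1 / v (Suc n)\<close> is the increment of \<open>V\<close>, which
      brings the term into the form of \<open>diff_div_sqrt_le\<close>.\<close>
    have "1 / h (Suc n) = (V (Suc n) - V n) / sqrt (V (Suc n))"
      by (simp add: h_def V_def)
    also have "\<dots> \<le> 2 * (sqrt (V (Suc n)) - sqrt (V n))"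
      using V0[of n] v[of "Suc n"] by (intro diff_div_sqrt_le) (auto simp: V_def)
    finally show ?case using Suc by simp
  qed
  have cs: "(\<Sum>k\<le>n. x k)\<^sup>2 \<le> (\<Sum>k\<le>n. h k * (x k)\<^sup>2) * (2 * sqrt (V n))" for n
  proof -
    have "(\<Sum>k\<le>n. x k)\<^sup>2 = (\<Sum>k\<le>n. (sqrt (h k) * x k) * (1 / sqrt (h k)))\<^sup>2"
      using h0 by (intro arg_cong[where f="\<lambda>y. y\<^sup>2"] sum.cong) (auto simp: less_imp_neq[symmetric])
    also have "\<dots> \<le> (\<Sum>k\<le>n. (sqrt (h k) * x k)\<^sup>2) * (\<Sum>k\<le>n. (1 / sqrt (h k))\<^sup>2)"
      by (rule Cauchy_Schwarz_ineq_sum)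
    also have "\<dots> = (\<Sum>k\<le>n. h k * (x k)\<^sup>2) * (\<Sum>k\<le>n. 1 / h k)"
      using h0 by (simp add: power_mult_distrib power_divide less_imp_le)
    also have "\<dots> \<le> (\<Sum>k\<le>n. h k * (x k)\<^sup>2) * (2 * sqrt (V n))"
      using h0 by (intro mult_left_mono inv_h sum_nonneg) (auto simp: less_imp_le)
    finally show ?thesis .
  qed
  have tail: "(\<Sum>n=k..<N. (W n - W (Suc n)) * sqrt (V n)) \<le> 2 * sqrt B * sqrt (W k)" for k
  proof -
    \<comment> \<open>If \<open>W n = 0\<close> then \<open>W (Suc n) = 0\<close> too, and both
      sides vanish. Otherwise \<open>W n * V n \<le> B\<close> replaces \<open>sqrt (V n)\<close> by
      \<open>sqrt B / sqrt (W n)\<close>, and \<open>diff_div_sqrt_le\<close> applies to the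
      decrements of \<open>W\<close>.\<close>
    have step: "(W n - W (Suc n)) * sqrt (V n) \<le> 2 * sqrt B * (sqrt (W n) - sqrt (W (Suc n)))" for n
    proof (cases "W n = 0")
      case True
      then show ?thesis using W0[of "Suc n"] W[of n] by simp
    next
      case False
      then have pos: "W n > 0" using W0[of n] by simp
      have "sqrt (W n) * sqrt (V n) \<le> sqrt B"
        using B[of n] by (simp add: real_sqrt_mult[symmetric])
      then have "sqrt (V n) \<le> sqrt B / sqrt (W n)"
        using pos by (simp add: field_simps)
      then have "(W n - W (Suc n)) * sqrt (V n) \<le> (W n - W (Suc n)) * (sqrt B / sqrt (W n))"
        using W[of n] by (intro mult_left_mono) auto
      also have "\<dots> = sqrt B * ((W n - W (Suc n)) / sqrt (W n))" by simp
      also have "\<dots> \<le> sqrt B * (2 * (sqrt (W n) - sqrt (W (Suc n))))"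
        using B0 W W0 by (intro mult_left_mono diff_div_sqrt_le) auto
      finally show ?thesis by (simp add: mult_ac)
    qed
    show ?thesis
    proof (cases "k \<le> N")
      case True
      have "(\<Sum>n=k..<N. (W n - W (Suc n)) * sqrt (V n))
          \<le> (\<Sum>n=k..<N. 2 * sqrt B * (sqrt (W n) - sqrt (W (Suc n))))"
        by (intro sum_mono step)
      also have "\<dots> = 2 * sqrt B * (sqrt (W k) - sqrt (W N))"
        using sum_Suc_diff'[OF True, of "\<lambda>n. - sqrt (W n)"]
        by (simp add: sum_distrib_left[symmetric])
      also have "\<dots> \<le> 2 * sqrt B * sqrt (W k)"
        using B0 W0[of N] by (intro mult_left_mono) auto
      finally show ?thesis .
    qed (use B0 W0[of k] in auto)
  qed
  have "(\<Sum>n<N. (W n - W (Suc n)) * (\<Sum>k\<le>n. x k)\<^sup>2)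
      \<le> (\<Sum>n<N. (W n - W (Suc n)) * ((\<Sum>k\<le>n. h k * (x k)\<^sup>2) * (2 * sqrt (V n))))"
    using W by (intro sum_mono mult_left_mono cs) auto
  \<comment> \<open>Conditional terms over a square range of indices make the summations
    exchangeable.\<close>
  also have "\<dots> = (\<Sum>n<N. \<Sum>k<N. if k \<le> n then h k * (x k)\<^sup>2 * 2 * ((W n - W (Suc n)) * sqrt (V n)) else 0)"
  proof (intro sum.cong refl)
    fix n assume "n \<in> {..<N}"
    then have "{..<N} \<inter> {k. k \<le> n} = {..n}" by auto
    then show "(W n - W (Suc n)) * ((\<Sum>k\<le>n. h k * (x k)\<^sup>2) * (2 * sqrt (V n)))
       = (\<Sum>k<N. if k \<le> n then h k * (x k)\<^sup>2 * 2 * ((W n - W (Suc n)) * sqrt (V n)) else 0)"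
      by (simp add: sum.If_cases sum_distrib_left sum_distrib_right mult_ac)
  qed
  also have "\<dots> = (\<Sum>k<N. \<Sum>n<N. if k \<le> n then h k * (x k)\<^sup>2 * 2 * ((W n - W (Suc n)) * sqrt (V n)) else 0)"
    by (rule sum.swap)
  also have "\<dots> = (\<Sum>k<N. h k * (x k)\<^sup>2 * 2 * (\<Sum>n=k..<N. (W n - W (Suc n)) * sqrt (V n)))"
  proof (intro sum.cong refl)
    fix k
    have "{..<N} \<inter> {n. k \<le> n} = {k..<N}" by auto
    then show "(\<Sum>n<N. if k \<le> n then h k * (x k)\<^sup>2 * 2 * ((W n - W (Suc n)) * sqrt (V n)) else 0)
       = h k * (x k)\<^sup>2 * 2 * (\<Sum>n=k..<N. (W n - W (Suc n)) * sqrt (V n))"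
      by (simp add: sum.If_cases sum_distrib_left)
  qed
  also have "\<dots> \<le> (\<Sum>k<N. h k * (x k)\<^sup>2 * 2 * (2 * sqrt B * sqrt (W k)))"
    using h0 by (intro sum_mono mult_left_mono tail) (auto simp: less_imp_le)
  \<comment> \<open>The auxiliary factor \<open>sqrt (V k)\<close> inside \<open>h k\<close> now
    meets \<open>sqrt (W k)\<close>, and their product is at most \<open>sqrt B\<close>. The 4
    collects one factor 2 from each inner sum.\<close>
  also have "\<dots> \<le> (\<Sum>k<N. 4 * B * (v k * (x k)\<^sup>2))"
  proof (intro sum_mono)
    fix k
    have "sqrt (W k) * sqrt (V k) \<le> sqrt B"
      using B[of k] by (simp add: real_sqrt_mult[symmetric])
    then have "sqrt B * (sqrt (W k) * sqrt (V k)) \<le> sqrt B * sqrt B"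
      using B0 by (intro mult_left_mono) auto
    then have "4 * (v k * (x k)\<^sup>2) * (sqrt B * (sqrt (W k) * sqrt (V k))) \<le> 4 * (v k * (x k)\<^sup>2) * B"
      using B0 v[of k] by (intro mult_left_mono) auto
    then show "h k * (x k)\<^sup>2 * 2 * (2 * sqrt B * sqrt (W k)) \<le> 4 * B * (v k * (x k)\<^sup>2)"
      by (simp add: h_def mult_ac)
  qed
  finally show ?thesis by (simp add: sum_distrib_left)
qed

subsection \<open>The Dirichlet space as a weighted sequence space\<close>

definition dirichlet_weight :: "nat \<Rightarrow> real" where
  "dirichlet_weight n = (if n = 0 then 1 else real n)"

text \<open>The sequence \<open>V\<close> of \<open>weighted_hardy\<close> for the weight of the
  Dirichlet norm.\<close>

definition dirichlet_weight_sum :: "nat \<Rightarrow> real" where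
  "dirichlet_weight_sum n = (\<Sum>k\<le>n. 1 / dirichlet_weight k)"

lemma dirichlet_weight_ge_1: "dirichlet_weight n \<ge> 1"
  by (simp add: dirichlet_weight_def)

lemma dirichlet_weight_sum_eq_harm: "dirichlet_weight_sum n = 1 + harm n"
proof (induction n)
  case (Suc n)
  have "dirichlet_weight_sum (Suc n) = dirichlet_weight_sum n + 1 / real (Suc n)"
    by (simp add: dirichlet_weight_sum_def dirichlet_weight_def)
  then show ?case using Suc by (simp add: harm_Suc inverse_eq_divide)
qed (simp add: dirichlet_weight_sum_def dirichlet_weight_def harm_def)

text \<open>Since harmonic numbers minus logarithms decrease, the sum is at most
  \<open>2 + ln (real n)\<close> for positive \<open>n\<close>; as \<open>ln 2\<close> is at least
  2/3, the 2 costs at most \<open>3 * ln (real n + 2)\<close>.\<close>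

lemma dirichlet_weight_sum_le: "dirichlet_weight_sum n \<le> 4 * ln (real n + 2)"
proof (cases "n = 0")
  case True
  then show ?thesis using ln2_ge_two_thirds by (simp add: dirichlet_weight_sum_eq_harm harm_def)
next
  case False
  then have "harm n - ln (real n) \<le> harm 1 - ln (real 1)"
    by (intro euler_mascheroni_sequence_decreasing) auto
  then have "dirichlet_weight_sum n \<le> 2 + ln (real n)"
    by (simp add: dirichlet_weight_sum_eq_harm harm_def)
  moreover have "ln (real n) \<le> ln (real n + 2)" using False by simp
  moreover have "ln 2 \<le> ln (real n + 2)" by simp
  ultimately show ?thesis using ln2_ge_two_thirds by linarith
qed

text \<open>The left side is the quantity that also bounds the squared norms of the kernels in
  \<open>kernel_partial_sum_ge\<close>.\<close>

lemma dirichlet_weight_sum_ge: "1 + ln (real n + 2) \<le> 2 * dirichlet_weight_sum n"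
proof -
  have "ln (real n + 2) \<le> ln (2 * (real n + 1))" by simp
  also have "\<dots> = ln 2 + ln (real n + 1)" by (rule ln_mult_pos) auto
  also have "ln 2 \<le> (1 :: real)" using ln_le_minus_one[of 2] by simp
  finally show ?thesis
    using harm_ge_ln[of n] harm_nonneg[of n, where 'a=real] by (simp add: dirichlet_weight_sum_eq_harm)
qed

lemma dirichlet_norm_nonneg: "f \<in> dirichlet_space \<Longrightarrow> 0 \<le> dirichlet_norm f"
  unfolding dirichlet_norm_def set_lebesgue_integral_def by simp

lemma dirichlet_norm_sums:
  assumes f: "f \<in> dirichlet_space"
  shows "(\<lambda>n. dirichlet_weight n * (cmod (taylor_coeff f n))\<^sup>2) sums (dirichlet_norm f)\<^sup>2"
proof -
  let ?c = "\<lambda>n. real n * (cmod (taylor_coeff f n))\<^sup>2"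
  have "summable ?c"
    using f dirichlet_space_iff[of f] by (simp add: dirichlet_space_def)
  then have "?c sums suminf ?c" by (rule summable_sums)
  from sums_add[OF sums_single[of 0 "\<lambda>n. (cmod (taylor_coeff f n))\<^sup>2"] this]
  have "(\<lambda>n. (if n = 0 then (cmod (taylor_coeff f n))\<^sup>2 else 0) + ?c n) sums (dirichlet_norm f)\<^sup>2"
    by (simp only: dirichlet_norm_eq[OF f])
  then show ?thesis
    by (rule sums_cong[THEN iffD1, rotated]) (simp add: dirichlet_weight_def)
qed

lemma summable_dirichlet_weight_iff:
  "summable (\<lambda>n. dirichlet_weight n * c n) \<longleftrightarrow> summable (\<lambda>n. real n * c n)" for c :: "nat \<Rightarrow> real"
  by (rule summable_cong) (auto simp: dirichlet_weight_def eventually_sequentially intro!: exI[of _ 1])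

text \<open>Weights of at least 1 make \<open>b\<close> bounded, so a geometric series dominates the
  power series at each point of the disk. Functions with prescribed coefficients are obtained from
  here.\<close>

lemma power_series_in_dirichlet_space:
  fixes b :: "nat \<Rightarrow> complex"
  assumes sb: "summable (\<lambda>n. dirichlet_weight n * (cmod (b n))\<^sup>2)"
  defines "f \<equiv> \<lambda>z. \<Sum>n. b n * z ^ n"
  shows "f \<in> dirichlet_space" "taylor_coeff f = b"
    and "\<And>z. z \<in> ball 0 1 \<Longrightarrow> summable (\<lambda>n. b n * z ^ n)"
proof -
  have "(\<lambda>n. dirichlet_weight n * (cmod (b n))\<^sup>2) \<longlonglongrightarrow> 0"
    using sb by (rule summable_LIMSEQ_zero)
  then have "Bseq (\<lambda>n. dirichlet_weight n * (cmod (b n))\<^sup>2)"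
    by (intro convergent_imp_Bseq convergentI)
  then obtain K where K: "\<And>n. \<bar>dirichlet_weight n * (cmod (b n))\<^sup>2\<bar> \<le> K"
    by (auto simp: Bseq_def)
  have bK: "cmod (b n) \<le> sqrt K" for n
  proof (rule real_le_rsqrt)
    have "1 * (cmod (b n))\<^sup>2 \<le> dirichlet_weight n * (cmod (b n))\<^sup>2"
      using dirichlet_weight_ge_1 by (intro mult_right_mono) auto
    then show "(cmod (b n))\<^sup>2 \<le> K" using K[of n] by simp
  qed
  show sum: "summable (\<lambda>n. b n * z ^ n)" if "z \<in> ball 0 1" for z
  proof (rule summable_comparison_test')
    show "summable (\<lambda>n. sqrt K * cmod z ^ n)"
      using that by (intro summable_mult summable_geometric) auto
    show "norm (b n * z ^ n) \<le> sqrt K * cmod z ^ n" if "n \<ge> 0" for n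
      using bK[of n] by (simp add: norm_mult norm_power mult_right_mono)
  qed
  have sums: "(\<lambda>n. b n * z ^ n) sums f z" if "z \<in> ball 0 1" for z
    using sum[OF that] by (simp add: f_def summable_sums)
  show t: "taylor_coeff f = b" by (rule taylor_coeff_unique(2)[OF sums])
  show "f \<in> dirichlet_space"
    using dirichlet_space_iff[OF taylor_coeff_unique(1)[OF sums]] sb
    by (simp only: t summable_dirichlet_weight_iff)
qed

section \<open>Linear combinations and coefficientwise convergence\<close>

lemma taylor_coeff_lincomb:
  assumes "f holomorphic_on ball 0 1" "g holomorphic_on ball 0 1"
  shows "taylor_coeff (\<lambda>w. a * f w + b * g w) = (\<lambda>n. a * taylor_coeff f n + b * taylor_coeff g n)"
proof (rule taylor_coeff_unique(2))
  fix z :: complex assume "z \<in> ball 0 1"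
  then have "(\<lambda>n. a * (taylor_coeff f n * z ^ n) + b * (taylor_coeff g n * z ^ n)) sums (a * f z + b * g z)"
    using assms by (intro sums_add sums_mult taylor_sums) auto
  then show "(\<lambda>n. (a * taylor_coeff f n + b * taylor_coeff g n) * z ^ n) sums (a * f z + b * g z)"
    by (simp add: algebra_simps)
qed

text \<open>The square of a sum is at most twice the sum of the squares. Summed over the
  coefficients, this takes the place of the triangle inequality for the norm, at the cost of a
  constant.\<close>

lemma weighted_norm_lincomb_le:
  fixes x y :: complex
  assumes "0 \<le> v"
  shows "v * (cmod (a * x + b * y))\<^sup>2
    \<le> 2 * (cmod a)\<^sup>2 * (v * (cmod x)\<^sup>2) + 2 * (cmod b)\<^sup>2 * (v * (cmod y)\<^sup>2)"
proof -
  have "(cmod (a * x + b * y))\<^sup>2 \<le> (cmod a * cmod x + cmod b * cmod y)\<^sup>2"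
    by (intro power_mono) (auto simp: norm_mult[symmetric] norm_triangle_ineq)
  also have "\<dots> \<le> 2 * (cmod a * cmod x)\<^sup>2 + 2 * (cmod b * cmod y)\<^sup>2"
    using sum_squares_bound[of "cmod a * cmod x" "cmod b * cmod y"] by (simp add: power2_sum)
  finally have "v * (cmod (a * x + b * y))\<^sup>2 \<le> v * (2 * (cmod a * cmod x)\<^sup>2 + 2 * (cmod b * cmod y)\<^sup>2)"
    using assms by (rule mult_left_mono)
  then show ?thesis by (simp add: power_mult_distrib algebra_simps)
qed

lemma dirichlet_space_lincomb:
  assumes f: "f \<in> dirichlet_space" and g: "g \<in> dirichlet_space"
  shows "(\<lambda>w. a * f w + b * g w) \<in> dirichlet_space"
    and "(dirichlet_norm (\<lambda>w. a * f w + b * g w))\<^sup>2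
      \<le> 2 * (cmod a)\<^sup>2 * (dirichlet_norm f)\<^sup>2 + 2 * (cmod b)\<^sup>2 * (dirichlet_norm g)\<^sup>2"
proof -
  have hol: "f holomorphic_on ball 0 1" "g holomorphic_on ball 0 1"
    using f g by (auto simp: dirichlet_space_def)
  let ?h = "\<lambda>w. a * f w + b * g w"
  let ?c = "\<lambda>n. dirichlet_weight n * (cmod (taylor_coeff ?h n))\<^sup>2"
  have R: "(\<lambda>n. 2 * (cmod a)\<^sup>2 * (dirichlet_weight n * (cmod (taylor_coeff f n))\<^sup>2)
      + 2 * (cmod b)\<^sup>2 * (dirichlet_weight n * (cmod (taylor_coeff g n))\<^sup>2))
    sums (2 * (cmod a)\<^sup>2 * (dirichlet_norm f)\<^sup>2 + 2 * (cmod b)\<^sup>2 * (dirichlet_norm g)\<^sup>2)"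
    by (intro sums_add sums_mult dirichlet_norm_sums f g)
  have w0: "0 \<le> dirichlet_weight n" for n using dirichlet_weight_ge_1[of n] by simp
  have le: "?c n \<le> 2 * (cmod a)\<^sup>2 * (dirichlet_weight n * (cmod (taylor_coeff f n))\<^sup>2)
      + 2 * (cmod b)\<^sup>2 * (dirichlet_weight n * (cmod (taylor_coeff g n))\<^sup>2)" for n
    unfolding taylor_coeff_lincomb[OF hol] by (rule weighted_norm_lincomb_le[OF w0])
  have "summable ?c"
    by (rule summable_comparison_test'[OF sums_summable[OF R], of 0]) (use le w0 in auto)
  moreover have "?h holomorphic_on ball 0 1"
    using hol by (intro holomorphic_intros)
  ultimately show h: "?h \<in> dirichlet_space"
    by (simp only: dirichlet_space_iff summable_dirichlet_weight_iff)
  show "(dirichlet_norm ?h)\<^sup>2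
      \<le> 2 * (cmod a)\<^sup>2 * (dirichlet_norm f)\<^sup>2 + 2 * (cmod b)\<^sup>2 * (dirichlet_norm g)\<^sup>2"
    by (rule sums_le[OF le dirichlet_norm_sums[OF h] R])
qed

lemma taylor_coeff_cesaro:
  assumes "cesaro_well_defined \<eta> f"
  shows "taylor_coeff (cesaro \<eta> f) = cesaro_coeff \<eta> f"
  by (rule taylor_coeff_unique(2))
     (use assms in \<open>auto simp: cesaro_well_defined_def cesaro_def summable_sums\<close>)

lemma bounded_coeff_convergent_subseq:
  fixes a :: "nat \<Rightarrow> nat \<Rightarrow> complex"
  assumes "\<And>n k. cmod (a n k) \<le> B"
  obtains r :: "nat \<Rightarrow> nat" where "strict_mono r" "\<And>k. convergent (\<lambda>n. a (r n) k)"
proof -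
  interpret subseqs "\<lambda>k s. convergent (\<lambda>n. a (s n) k)"
  proof
    fix k and s :: "nat \<Rightarrow> nat"
    have "bounded (range (\<lambda>n. a (s n) k))"
      using assms by (intro boundedI[of _ B]) auto
    from bounded_imp_convergent_subsequence[OF this]
    show "\<exists>r'. strict_mono r' \<and> convergent (\<lambda>n. a ((s \<circ> r') n) k)"
      by (auto simp: o_def convergent_def)
  qed
  have "convergent (\<lambda>n. a (diagseq n) k)" for k
  proof -
    \<comment> \<open>From index \<open>Suc k\<close> on, the diagonal sequence is a subsequence of
      the one chosen for coefficient \<open>k\<close>; the entries before do not affect
      convergence.\<close>
    have "convergent (\<lambda>n. a ((diagseq \<circ> ((+) (Suc k))) n) k)"
    proof (rule diagseq_holds)
      fix r s :: "nat \<Rightarrow> nat" and n assume "strict_mono r" "convergent (\<lambda>i. a (s i) n)"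
      then show "convergent (\<lambda>i. a ((s \<circ> r) i) n)"
        using convergent_subseq_convergent[of "\<lambda>i. a (s i) n" r] by (simp add: o_def)
    qed
    then show ?thesis
      using convergent_ignore_initial_segment[of "\<lambda>n. a (diagseq n) k" "Suc k"]
      by (simp add: o_def add.commute)
  qed
  with subseq_diagseq that show thesis by blast
qed

text \<open>All weights are at least 1. Hence norm-bounded sequences have uniformly bounded
  coefficients, and norm convergence implies coefficientwise convergence.\<close>

lemma taylor_coeff_norm_le:
  assumes "f \<in> dirichlet_space"
  shows "cmod (taylor_coeff f n) \<le> dirichlet_norm f"
proof (rule power2_le_imp_le)
  have w: "0 \<le> dirichlet_weight k * (cmod (taylor_coeff f k))\<^sup>2" for k
    using dirichlet_weight_ge_1[of k] by simp
  have "1 * (cmod (taylor_coeff f n))\<^sup>2 \<le> dirichlet_weight n * (cmod (taylor_coeff f n))\<^sup>2"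
    by (intro mult_right_mono dirichlet_weight_ge_1) auto
  also have "\<dots> \<le> (dirichlet_norm f)\<^sup>2"
    using sum_le_suminf[OF sums_summable[OF dirichlet_norm_sums[OF assms]], of "{n}"] w
      sums_unique[OF dirichlet_norm_sums[OF assms]] by simp
  finally show "(cmod (taylor_coeff f n))\<^sup>2 \<le> (dirichlet_norm f)\<^sup>2" by simp
qed (rule dirichlet_norm_nonneg[OF assms])

text \<open>The norm is determined by the coefficients, so functions that may differ outside the
  disk can be exchanged under it.\<close>

lemma dirichlet_norm_eqI:
  assumes "f \<in> dirichlet_space" "g \<in> dirichlet_space" "taylor_coeff f = taylor_coeff g"
  shows "dirichlet_norm f = dirichlet_norm g"
proof -
  have "(dirichlet_norm f)\<^sup>2 = (dirichlet_norm g)\<^sup>2"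
    using sums_unique2[OF dirichlet_norm_sums[OF assms(1)]] dirichlet_norm_sums[OF assms(2)] assms(3)
    by simp
  then show ?thesis using assms dirichlet_norm_nonneg by (simp add: power2_eq_iff_nonneg)
qed

subsection \<open>The Cesaro operator\<close>

lemma cesaro_coeff_lincomb:
  assumes "f holomorphic_on ball 0 1" "g holomorphic_on ball 0 1"
  shows "cesaro_coeff \<eta> (\<lambda>w. a * f w + b * g w) n = a * cesaro_coeff \<eta> f n + b * cesaro_coeff \<eta> g n"
  unfolding cesaro_coeff_def taylor_coeff_lincomb[OF assms]
  by (simp add: sum.distrib sum_distrib_left algebra_simps)

definition cesaro_weight :: "(nat \<Rightarrow> complex) \<Rightarrow> nat \<Rightarrow> real" where
  "cesaro_weight \<eta> n = dirichlet_weight n * (cmod (\<eta> n))\<^sup>2"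

definition cesaro_tail :: "(nat \<Rightarrow> complex) \<Rightarrow> nat \<Rightarrow> real" where
  "cesaro_tail \<eta> m = (\<Sum>n. cesaro_weight \<eta> (n + m))"

lemma cesaro_weight_nonneg: "0 \<le> cesaro_weight \<eta> n"
  using dirichlet_weight_ge_1[of n] by (simp add: cesaro_weight_def)

lemma cesaro_tail_nonneg:
  assumes "summable (cesaro_weight \<eta>)"
  shows "0 \<le> cesaro_tail \<eta> m"
  unfolding cesaro_tail_def using assms by (intro suminf_nonneg cesaro_weight_nonneg summable_ignore_initial_segment)

lemma cesaro_tail_Suc:
  assumes "summable (cesaro_weight \<eta>)"
  shows "cesaro_tail \<eta> m = cesaro_weight \<eta> m + cesaro_tail \<eta> (Suc m)"
  unfolding cesaro_tail_def
  using suminf_split_head[OF summable_ignore_initial_segment[OF assms, of m]] by simp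

lemma weighted_norm_cesaro_coeff:
  "dirichlet_weight n * (cmod (cesaro_coeff \<eta> f n))\<^sup>2
    = cesaro_weight \<eta> n * (cmod (\<Sum>k\<le>n. taylor_coeff f k))\<^sup>2"
  by (simp add: cesaro_coeff_def cesaro_weight_def norm_mult power_mult_distrib)

text \<open>Replacing the factor \<open>real n\<close> by \<open>dirichlet_weight n\<close> changes
  only the term at 0, hence at most the tail at \<open>m = 0\<close>, and neither summability nor
  the limit.\<close>

lemma tail_condition_iff:
  "tail_condition \<eta> \<longleftrightarrow>
     summable (cesaro_weight \<eta>) \<and> (\<lambda>m. cesaro_tail \<eta> m * ln (real m + 2)) \<longlonglongrightarrow> 0"
proof -
  let ?T = "\<lambda>m. \<Sum>n. real (n + m) * (cmod (\<eta> (n + m)))\<^sup>2"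
  have eq: "?T m = cesaro_tail \<eta> m" if "m \<ge> 1" for m
    using that unfolding cesaro_tail_def cesaro_weight_def
    by (intro suminf_cong) (simp add: dirichlet_weight_def)
  have "?T \<in> o(\<lambda>m. 1 / ln (real m + 2)) \<longleftrightarrow> (\<lambda>m. ?T m / (1 / ln (real m + 2))) \<longlonglongrightarrow> 0"
    by (rule iffI[OF smalloD_tendsto smalloI_tendsto]) auto
  also have "\<dots> \<longleftrightarrow> (\<lambda>m. cesaro_tail \<eta> m * ln (real m + 2)) \<longlonglongrightarrow> 0"
    by (rule tendsto_cong) (use eq in \<open>auto simp: eventually_sequentially intro!: exI[of _ 1]\<close>)
  finally show ?thesis
    unfolding tail_condition_def
    using summable_dirichlet_weight_iff[of "\<lambda>n. (cmod (\<eta> n))\<^sup>2"]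
    by (simp add: cesaro_weight_def[abs_def])
qed

text \<open>Tails frozen at their value in \<open>M\<close> have decrement 0 before \<open>M\<close>
  and \<open>cesaro_weight\<close> from there on. With them, \<open>weighted_hardy\<close> bounds
  the late outputs while the inner sums still start at 0.\<close>

lemma cesaro_partial_sum_estimate:
  assumes sum: "summable (cesaro_weight \<eta>)"
    and B: "\<And>m. m \<ge> M \<Longrightarrow> cesaro_tail \<eta> m * dirichlet_weight_sum m \<le> B"
  shows "(\<Sum>n\<in>{M..<N}. cesaro_weight \<eta> n * (cmod (\<Sum>k\<le>n. a k))\<^sup>2)
    \<le> 4 * B * (\<Sum>k<N. dirichlet_weight k * (cmod (a k))\<^sup>2)"
proof -
  define W where "W n = cesaro_tail \<eta> (max n M)" for n
  have dw: "dirichlet_weight k > 0" for k using dirichlet_weight_ge_1[of k] by simp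
  have W0: "W n \<ge> 0" for n by (simp add: W_def cesaro_tail_nonneg sum)
  have W_diff: "W n - W (Suc n) = (if n \<ge> M then cesaro_weight \<eta> n else 0)" for n
    using cesaro_tail_Suc[OF sum, of n] by (auto simp: W_def max_def not_less_eq_eq)
  \<comment> \<open>Below \<open>M\<close> the partial sum of the inverse weights is at most the one
    at \<open>M\<close>, so the hypothesis on \<open>m \<ge> M\<close> is enough.\<close>
  have W_B: "W n * (\<Sum>k\<le>n. 1 / dirichlet_weight k) \<le> B" for n
  proof -
    have "(\<Sum>k\<le>n. 1 / dirichlet_weight k) \<le> dirichlet_weight_sum (max n M)"
      unfolding dirichlet_weight_sum_def using dw by (intro sum_mono2) (auto simp: less_imp_le)
    then have "W n * (\<Sum>k\<le>n. 1 / dirichlet_weight k) \<le> W n * dirichlet_weight_sum (max n M)"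
      using W0 by (intro mult_left_mono) auto
    also have "\<dots> \<le> B" unfolding W_def by (intro B) auto
    finally show ?thesis .
  qed
  have "(\<Sum>n\<in>{M..<N}. cesaro_weight \<eta> n * (cmod (\<Sum>k\<le>n. a k))\<^sup>2)
      \<le> (\<Sum>n\<in>{M..<N}. (W n - W (Suc n)) * (\<Sum>k\<le>n. cmod (a k))\<^sup>2)"
    by (intro sum_mono) (auto simp: W_diff cesaro_weight_nonneg intro!: mult_left_mono power_mono norm_sum)
  also have "\<dots> \<le> (\<Sum>n<N. (W n - W (Suc n)) * (\<Sum>k\<le>n. cmod (a k))\<^sup>2)"
    by (intro sum_mono2) (auto simp: W_diff cesaro_weight_nonneg)
  also have "\<dots> \<le> 4 * B * (\<Sum>k<N. dirichlet_weight k * (cmod (a k))\<^sup>2)"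
  proof (rule weighted_hardy[OF dw _ W0 _ W_B])
    show "W (Suc n) \<le> W n" for n
      using W_diff[of n] cesaro_weight_nonneg[of \<eta> n] by (simp split: if_splits)
  qed simp
  finally show ?thesis .
qed

text \<open>Outputs below \<open>M\<close> involve finitely many Taylor coefficients; those from
  \<open>M\<close> on are controlled by the Hardy constant. A bound valid for all \<open>m\<close>
  yields that the operator maps the space into itself, a small \<open>B\<close> with large
  \<open>M\<close> yields compactness.\<close>

lemma cesaro_estimate:
  assumes sum: "summable (cesaro_weight \<eta>)"
    and B: "\<And>m. m \<ge> M \<Longrightarrow> cesaro_tail \<eta> m * dirichlet_weight_sum m \<le> B"
    and f: "f \<in> dirichlet_space"
  shows "cesaro_well_defined \<eta> f" and "cesaro \<eta> f \<in> dirichlet_space"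
    and "(dirichlet_norm (cesaro \<eta> f))\<^sup>2
      \<le> (\<Sum>n<M. cesaro_weight \<eta> n * (cmod (\<Sum>k\<le>n. taylor_coeff f k))\<^sup>2) + 4 * B * (dirichlet_norm f)\<^sup>2"
proof -
  define c where "c n = cesaro_weight \<eta> n * (cmod (\<Sum>k\<le>n. taylor_coeff f k))\<^sup>2" for n
  let ?K = "(\<Sum>n<M. c n) + 4 * B * (dirichlet_norm f)\<^sup>2"
  have c0: "0 \<le> c n" for n by (simp add: c_def cesaro_weight_nonneg)
  have "0 \<le> cesaro_tail \<eta> M * dirichlet_weight_sum M"
    using harm_nonneg[of M, where 'a=real]
    by (intro mult_nonneg_nonneg cesaro_tail_nonneg sum) (simp add: dirichlet_weight_sum_eq_harm)
  also have "\<dots> \<le> B" by (rule B) simp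
  finally have B0: "0 \<le> B" .
  have dw: "0 \<le> dirichlet_weight k" for k using dirichlet_weight_ge_1[of k] by simp
  have part: "(\<Sum>n<N. c n) \<le> ?K" for N
  proof -
    \<comment> \<open>Only an inequality, because \<open>N\<close> may lie below
      \<open>M\<close>.\<close>
    have "(\<Sum>n<N. c n) \<le> (\<Sum>n\<in>{..<M} \<union> {M..<N}. c n)"
      using c0 by (intro sum_mono2) auto
    also have "\<dots> = (\<Sum>n<M. c n) + (\<Sum>n\<in>{M..<N}. c n)"
      by (intro sum.union_disjoint) auto
    also have "(\<Sum>n\<in>{M..<N}. c n) \<le> 4 * B * (\<Sum>k<N. dirichlet_weight k * (cmod (taylor_coeff f k))\<^sup>2)"
      unfolding c_def by (rule cesaro_partial_sum_estimate[OF sum B])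
    also have "\<dots> \<le> 4 * B * (dirichlet_norm f)\<^sup>2"
      using sum_le_suminf[OF sums_summable[OF dirichlet_norm_sums[OF f]], of "{..<N}"] dw B0
        sums_unique[OF dirichlet_norm_sums[OF f]]
      by (intro mult_left_mono) auto
    finally show ?thesis by simp
  qed
  have sc: "summable c"
    by (rule bounded_imp_summable[of c ?K]) (use c0 part[of "Suc _"] in \<open>auto simp: lessThan_Suc_atMost\<close>)
  have c_eq: "c = (\<lambda>n. dirichlet_weight n * (cmod (cesaro_coeff \<eta> f n))\<^sup>2)"
    by (simp add: c_def fun_eq_iff weighted_norm_cesaro_coeff)
  note ps = power_series_in_dirichlet_space[OF sc[unfolded c_eq]]
  show D: "cesaro \<eta> f \<in> dirichlet_space"
    using ps(1) by (simp add: cesaro_def[abs_def])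
  then show "cesaro_well_defined \<eta> f"
    using ps(3) by (simp add: cesaro_well_defined_def dirichlet_space_def)
  then have "taylor_coeff (cesaro \<eta> f) = cesaro_coeff \<eta> f" by (rule taylor_coeff_cesaro)
  then have "c sums (dirichlet_norm (cesaro \<eta> f))\<^sup>2"
    using dirichlet_norm_sums[OF D] by (simp add: c_eq)
  then have "(dirichlet_norm (cesaro \<eta> f))\<^sup>2 = suminf c" by (rule sums_unique)
  also have "\<dots> \<le> ?K" by (rule suminf_le_const[OF sc part])
  finally show "(dirichlet_norm (cesaro \<eta> f))\<^sup>2
      \<le> (\<Sum>n<M. cesaro_weight \<eta> n * (cmod (\<Sum>k\<le>n. taylor_coeff f k))\<^sup>2) + 4 * B * (dirichlet_norm f)\<^sup>2"
    by (simp add: c_def)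
qed

section \<open>Compactness under the tail condition\<close>

lemma cesaro_lincomb:
  assumes "f holomorphic_on ball 0 1" "g holomorphic_on ball 0 1"
    and "cesaro_well_defined \<eta> f" "cesaro_well_defined \<eta> g" and z: "z \<in> ball 0 1"
  shows "cesaro \<eta> (\<lambda>w. a * f w + b * g w) z = a * cesaro \<eta> f z + b * cesaro \<eta> g z"
proof -
  have "(\<lambda>n. a * (cesaro_coeff \<eta> f n * z ^ n) + b * (cesaro_coeff \<eta> g n * z ^ n))
      sums (a * cesaro \<eta> f z + b * cesaro \<eta> g z)"
    using assms unfolding cesaro_def cesaro_well_defined_def
    by (intro sums_add sums_mult summable_sums) auto
  then show ?thesis
    unfolding cesaro_def cesaro_coeff_lincomb[OF assms(1,2)]
    by (simp add: sums_iff algebra_simps)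
qed

text \<open>Fatou's lemma for weighted sequences: the bound passes to the limit in each finite
  partial sum, hence to the whole series.\<close>

lemma dirichlet_space_coeff_limit:
  assumes F: "\<And>n. F n \<in> dirichlet_space" "\<And>n. dirichlet_norm (F n) \<le> B"
    and lim: "\<And>k. (\<lambda>n. taylor_coeff (F n) k) \<longlonglongrightarrow> l k"
  obtains f where "f \<in> dirichlet_space" "taylor_coeff f = l" "(dirichlet_norm f)\<^sup>2 \<le> B\<^sup>2"
proof -
  let ?c = "\<lambda>k. dirichlet_weight k * (cmod (l k))\<^sup>2"
  have dw: "0 \<le> dirichlet_weight k" for k using dirichlet_weight_ge_1[of k] by simp
  have part: "(\<Sum>k<N. ?c k) \<le> B\<^sup>2" for N
  proof (rule tendsto_upperbound)
    show "(\<lambda>n. \<Sum>k<N. dirichlet_weight k * (cmod (taylor_coeff (F n) k))\<^sup>2) \<longlonglongrightarrow> (\<Sum>k<N. ?c k)"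
      by (intro tendsto_intros lim)
    have "(\<Sum>k<N. dirichlet_weight k * (cmod (taylor_coeff (F n) k))\<^sup>2) \<le> B\<^sup>2" for n
    proof -
      have "(\<Sum>k<N. dirichlet_weight k * (cmod (taylor_coeff (F n) k))\<^sup>2) \<le> (dirichlet_norm (F n))\<^sup>2"
        using sum_le_suminf[OF sums_summable[OF dirichlet_norm_sums[OF F(1)[of n]]], of "{..<N}"] dw
          sums_unique[OF dirichlet_norm_sums[OF F(1)[of n]]] by auto
      also have "\<dots> \<le> B\<^sup>2"
        using F by (intro power_mono dirichlet_norm_nonneg) auto
      finally show ?thesis .
    qed
    then show "\<forall>\<^sub>F n in sequentially. (\<Sum>k<N. dirichlet_weight k * (cmod (taylor_coeff (F n) k))\<^sup>2) \<le> B\<^sup>2"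
      by simp
  qed simp
  have sc: "summable ?c"
    by (rule bounded_imp_summable[of ?c "B\<^sup>2"]) (use dw part[of "Suc _"] in \<open>auto simp: lessThan_Suc_atMost\<close>)
  define f where "f z = (\<Sum>n. l n * z ^ n)" for z
  note ps = power_series_in_dirichlet_space[OF sc]
  have D: "f \<in> dirichlet_space" and t: "taylor_coeff f = l"
    using ps(1,2) by (simp_all add: f_def[abs_def])
  have "(dirichlet_norm f)\<^sup>2 = suminf ?c"
    using sums_unique[OF dirichlet_norm_sums[OF D]] by (simp add: t)
  also have "\<dots> \<le> B\<^sup>2" by (rule suminf_le_const[OF sc part])
  finally show thesis using that D t by blast
qed

text \<open>A bounded sequence has a subsequence converging coefficientwise to some \<open>f\<close>
  in the space. The images of the differences \<open>d n\<close> then tend to 0 in norm: early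
  outputs by coefficientwise convergence, late ones by the small Hardy constant.\<close>

lemma tail_condition_imp_compact:
  assumes "tail_condition \<eta>"
  shows "cesaro_compact \<eta>"
proof -
  have sum: "summable (cesaro_weight \<eta>)" and lim: "(\<lambda>m. cesaro_tail \<eta> m * ln (real m + 2)) \<longlonglongrightarrow> 0"
    using assms by (auto simp: tail_condition_iff)
  let ?TV = "\<lambda>m. cesaro_tail \<eta> m * dirichlet_weight_sum m"
  have TV: "?TV \<longlonglongrightarrow> 0"
  proof (rule tendsto_sandwich[OF _ _ tendsto_const])
    show "(\<lambda>m. 4 * (cesaro_tail \<eta> m * ln (real m + 2))) \<longlonglongrightarrow> 0"
      using tendsto_mult[OF tendsto_const lim, of 4] by simp
    show "\<forall>\<^sub>F m in sequentially. 0 \<le> ?TV m"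
      using harm_nonneg[where 'a=real]
      by (auto simp: dirichlet_weight_sum_eq_harm intro!: mult_nonneg_nonneg cesaro_tail_nonneg sum always_eventually add_nonneg_nonneg)
    show "\<forall>\<^sub>F m in sequentially. ?TV m \<le> 4 * (cesaro_tail \<eta> m * ln (real m + 2))"
      using mult_left_mono[OF dirichlet_weight_sum_le cesaro_tail_nonneg[OF sum]]
      by (auto simp: mult_ac intro!: always_eventually)
  qed
  then have "Bseq ?TV" by (intro convergent_imp_Bseq convergentI)
  then obtain B0 where B0: "\<And>m. \<bar>?TV m\<bar> \<le> B0" by (auto simp: Bseq_def)
  have B0': "?TV m \<le> B0" for m using B0[of m] by simp
  have wd: "cesaro_well_defined \<eta> f" and CD: "cesaro \<eta> f \<in> dirichlet_space"
    if "f \<in> dirichlet_space" for f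
    using cesaro_estimate(1,2)[OF sum B0' that] by auto
  have hol: "f holomorphic_on ball 0 1" if "f \<in> dirichlet_space" for f
    using that by (simp add: dirichlet_space_def)
  have lin: "dirichlet_linear (cesaro \<eta>)"
    unfolding dirichlet_linear_def using CD cesaro_lincomb hol wd by auto
  have "\<exists>g\<in>dirichlet_space. \<exists>r. strict_mono r \<and>
           (\<lambda>n. dirichlet_norm (\<lambda>z. cesaro \<eta> (F (r n)) z - g z)) \<longlonglongrightarrow> 0"
    if F: "\<forall>n. F n \<in> dirichlet_space \<and> dirichlet_norm (F n) \<le> B" for F :: "nat \<Rightarrow> complex \<Rightarrow> complex" and B
  proof -
    have FD: "F n \<in> dirichlet_space" and FB: "dirichlet_norm (F n) \<le> B" for n using F by auto
    obtain r :: "nat \<Rightarrow> nat" where r: "strict_mono r"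
      and conv: "\<And>k. convergent (\<lambda>n. taylor_coeff (F (r n)) k)"
      using bounded_coeff_convergent_subseq[of "\<lambda>n k. taylor_coeff (F n) k" B]
        order_trans[OF taylor_coeff_norm_le[OF FD] FB] by blast
    define l where "l k = lim (\<lambda>n. taylor_coeff (F (r n)) k)" for k
    have l: "(\<lambda>n. taylor_coeff (F (r n)) k) \<longlonglongrightarrow> l k" for k
      using conv[of k] by (simp add: l_def convergent_LIMSEQ_iff)
    obtain f where f: "f \<in> dirichlet_space" "taylor_coeff f = l" "(dirichlet_norm f)\<^sup>2 \<le> B\<^sup>2"
      using dirichlet_space_coeff_limit[of "\<lambda>n. F (r n)" B l] FD FB l by blast
    \<comment> \<open>Written as a linear combination to match the lemmas on these
      literally.\<close>
    define d where "d n = (\<lambda>z. 1 * F (r n) z + (- 1) * f z)" for n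
    have dD: "d n \<in> dirichlet_space" for n
      unfolding d_def by (rule dirichlet_space_lincomb(1)[OF FD f(1)])
    have dB: "(dirichlet_norm (d n))\<^sup>2 \<le> 4 * B\<^sup>2" for n
    proof -
      have "(dirichlet_norm (d n))\<^sup>2 \<le> 2 * (dirichlet_norm (F (r n)))\<^sup>2 + 2 * (dirichlet_norm f)\<^sup>2"
        using dirichlet_space_lincomb(2)[OF FD[of "r n"] f(1), where a=1 and b="-1"] by (simp add: d_def)
      moreover have "(dirichlet_norm (F (r n)))\<^sup>2 \<le> B\<^sup>2"
        using FD FB by (intro power_mono dirichlet_norm_nonneg) auto
      ultimately show ?thesis using f(3) by simp
    qed
    have d0: "(\<lambda>n. taylor_coeff (d n) k) \<longlonglongrightarrow> 0" for k
    proof -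
      have "taylor_coeff (d n) k = taylor_coeff (F (r n)) k - l k" for n
        unfolding d_def
        using fun_cong[OF taylor_coeff_lincomb[OF hol[OF FD[of "r n"]] hol[OF f(1)], where a=1 and b="-1"], of k]
        by (simp add: f(2))
      then show ?thesis using tendsto_diff[OF l[of k] tendsto_const, of "l k"] by simp
    qed
    have norm_eq: "dirichlet_norm (\<lambda>z. cesaro \<eta> (F (r n)) z - cesaro \<eta> f z)
        = dirichlet_norm (cesaro \<eta> (d n))" for n
    proof (rule dirichlet_norm_eqI)
      show "(\<lambda>z. cesaro \<eta> (F (r n)) z - cesaro \<eta> f z) \<in> dirichlet_space"
        using dirichlet_space_lincomb(1)[OF CD[OF FD[of "r n"]] CD[OF f(1)], where a=1 and b="-1"] by simp
      show "cesaro \<eta> (d n) \<in> dirichlet_space" by (rule CD[OF dD])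
      have "taylor_coeff (\<lambda>z. cesaro \<eta> (F (r n)) z - cesaro \<eta> f z)
          = (\<lambda>k. cesaro_coeff \<eta> (F (r n)) k - cesaro_coeff \<eta> f k)"
        using taylor_coeff_lincomb[OF hol[OF CD[OF FD[of "r n"]]] hol[OF CD[OF f(1)]], where a=1 and b="-1"]
          taylor_coeff_cesaro[OF wd[OF FD[of "r n"]]] taylor_coeff_cesaro[OF wd[OF f(1)]] by simp
      also have "\<dots> = cesaro_coeff \<eta> (d n)"
        unfolding d_def cesaro_coeff_lincomb[OF hol[OF FD[of "r n"]] hol[OF f(1)]] fun_eq_iff by simp
      also have "\<dots> = taylor_coeff (cesaro \<eta> (d n))"
        by (rule taylor_coeff_cesaro[OF wd[OF dD], symmetric])
      finally show "taylor_coeff (\<lambda>z. cesaro \<eta> (F (r n)) z - cesaro \<eta> f z) = taylor_coeff (cesaro \<eta> (d n))" .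
    qed
    have "(\<lambda>n. (dirichlet_norm (cesaro \<eta> (d n)))\<^sup>2) \<longlonglongrightarrow> 0"
    proof (rule order_tendstoI)
      fix e :: real assume "e < 0"
      then show "\<forall>\<^sub>F n in sequentially. e < (dirichlet_norm (cesaro \<eta> (d n)))\<^sup>2"
        by (intro always_eventually allI) (smt (verit) zero_le_power2)
    next
      fix e :: real assume e: "e > 0"
      \<comment> \<open>The late outputs contribute at most
        \<open>4 * \<epsilon> * (4 * B\<^sup>2)\<close>, and 32 brings this below
        \<open>e / 2\<close>. The summand 1 covers \<open>B = 0\<close>.\<close>
      define \<epsilon> where "\<epsilon> = e / (32 * (B\<^sup>2 + 1))"
      have B1: "B\<^sup>2 + 1 > 0" by (smt (verit) zero_le_power2)
      have \<epsilon>: "\<epsilon> > 0" using e B1 by (simp add: \<epsilon>_def)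
      obtain M where M: "\<And>m. m \<ge> M \<Longrightarrow> ?TV m \<le> \<epsilon>"
        using order_tendstoD(2)[OF TV \<epsilon>] by (auto simp: eventually_sequentially intro: less_imp_le)
      let ?s = "\<lambda>n. \<Sum>j<M. cesaro_weight \<eta> j * (cmod (\<Sum>k\<le>j. taylor_coeff (d n) k))\<^sup>2"
      have "?s \<longlonglongrightarrow> (\<Sum>j<M. cesaro_weight \<eta> j * (cmod (\<Sum>k\<le>j. 0))\<^sup>2)"
        by (intro tendsto_intros d0)
      then have "?s \<longlonglongrightarrow> 0" by simp
      then have "\<forall>\<^sub>F n in sequentially. ?s n < e / 2"
        using e by (intro order_tendstoD(2)) auto
      then show "\<forall>\<^sub>F n in sequentially. (dirichlet_norm (cesaro \<eta> (d n)))\<^sup>2 < e"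
      proof eventually_elim
        case (elim n)
        have "(dirichlet_norm (cesaro \<eta> (d n)))\<^sup>2 \<le> ?s n + 4 * \<epsilon> * (dirichlet_norm (d n))\<^sup>2"
          by (rule cesaro_estimate(3)[OF sum M dD])
        also have "4 * \<epsilon> * (dirichlet_norm (d n))\<^sup>2 \<le> 4 * \<epsilon> * (4 * B\<^sup>2)"
          using \<epsilon> by (intro mult_left_mono dB) auto
        also have "4 * \<epsilon> * (4 * B\<^sup>2) \<le> e / 2"
          using e B1 by (simp add: \<epsilon>_def field_simps)
        finally show ?case using elim by simp
      qed
    qed
    then have "(\<lambda>n. dirichlet_norm (cesaro \<eta> (d n))) \<longlonglongrightarrow> 0"
      by (simp add: power_tendsto_0_iff)
    then show ?thesis
      using r CD[OF f(1)] by (intro bexI[of _ "cesaro \<eta> f"] exI[of _ r]) (simp_all add: norm_eq)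
  qed
  then show ?thesis
    unfolding cesaro_compact_def dirichlet_compact_def using wd lin by blast
qed

subsection \<open>The normalized reproducing kernels\<close>

text \<open>The diagonal value of the kernel at \<open>t\<close>, as a real number; see
  \<open>dirichlet_kernel_diagonal\<close>.\<close>

definition kernel_norm_sq :: "real \<Rightarrow> real" where
  "kernel_norm_sq t = 1 - ln (1 - t\<^sup>2)"

lemma kernel_norm_sq_ge_1: "0 < t \<Longrightarrow> t < 1 \<Longrightarrow> kernel_norm_sq t \<ge> 1"
  by (simp add: kernel_norm_sq_def abs_square_less_1 power_le_one)

lemma kernel_norm_sq_at_left: "filterlim kernel_norm_sq at_top (at_left 1)"
  unfolding kernel_norm_sq_def by real_asymp

text \<open>\<open>1 - z * complex_of_real t\<close> has positive real part and so avoids the branch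
  cut, where \<open>Ln\<close> of the inverse could differ from the negative of
  \<open>Ln\<close>.\<close>

lemma dirichlet_kernel_real:
  assumes t: "0 < t" "t < 1" and z: "cmod z < 1"
  shows "dirichlet_kernel (complex_of_real t) z = 1 - Ln (1 - z * complex_of_real t)"
proof -
  have "cmod (z * complex_of_real t) < 1"
    using t z mult_strict_mono[of "cmod z" 1 t 1] by (simp add: norm_mult)
  then have "Re (z * complex_of_real t) < 1"
    using complex_Re_le_cmod[of "z * complex_of_real t"] by linarith
  then have "1 - z * complex_of_real t \<notin> \<real>\<^sub>\<le>\<^sub>0"
    by (auto simp: complex_nonpos_Reals_iff)
  then show ?thesis
    using Ln_inverse[of "1 - z * complex_of_real t"] by (simp add: dirichlet_kernel_def inverse_eq_divide)
qed

lemma dirichlet_kernel_diagonal: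
  assumes t: "0 < t" "t < 1"
  shows "dirichlet_kernel (complex_of_real t) (complex_of_real t) = complex_of_real (kernel_norm_sq t)"
proof -
  have "1 - complex_of_real t * complex_of_real t = complex_of_real (1 - t\<^sup>2)"
    by (simp add: power2_eq_square)
  moreover have "0 < 1 - t\<^sup>2" using t by (simp add: abs_square_less_1)
  ultimately show ?thesis
    using t by (simp only: dirichlet_kernel_real kernel_norm_sq_def Ln_of_real norm_of_real) simp
qed

definition kernel_coeff :: "real \<Rightarrow> nat \<Rightarrow> real" where
  "kernel_coeff t n = t ^ n / dirichlet_weight n / sqrt (kernel_norm_sq t)"

lemma normalized_kernel_sums:
  assumes t: "0 < t" "t < 1" and z: "z \<in> ball 0 1"
  shows "(\<lambda>n. complex_of_real (kernel_coeff t n) * z ^ n) sums normalized_kernel (complex_of_real t) z"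
proof -
  have K: "kernel_norm_sq t \<ge> 1" using t by (rule kernel_norm_sq_ge_1)
  have "cmod (z * complex_of_real t) < 1"
    using t z mult_strict_mono[of "cmod z" 1 t 1] by (simp add: norm_mult)
  then have "(\<lambda>n. - ((z * complex_of_real t) ^ n) / of_nat n) sums Ln (1 - z * complex_of_real t)"
    using Ln_series'[of "- (z * complex_of_real t)"] by simp
  \<comment> \<open>The logarithmic series has the term 0 at index 0, by division by zero; the
    constant 1 of the kernel is inserted there.\<close>
  from sums_add[OF sums_single[of 0 "\<lambda>_. 1"] sums_minus[OF this]]
  have "(\<lambda>n. (if n = 0 then 1 else 0) + (z * complex_of_real t) ^ n / of_nat n)
      sums (1 - Ln (1 - z * complex_of_real t))" by simp
  then have "(\<lambda>n. ((if n = 0 then 1 else 0) + (z * complex_of_real t) ^ n / of_nat n) / csqrt (of_real (kernel_norm_sq t)))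
      sums normalized_kernel (complex_of_real t) z"
    unfolding normalized_kernel_def dirichlet_kernel_diagonal[OF t]
    using dirichlet_kernel_real[OF t, of z] z by (intro sums_divide) simp
  moreover have "((if n = 0 then 1 else 0) + (z * complex_of_real t) ^ n / of_nat n) / csqrt (of_real (kernel_norm_sq t))
      = complex_of_real (kernel_coeff t n) * z ^ n" for n
    using K by (auto simp: kernel_coeff_def dirichlet_weight_def csqrt_of_real_nonneg power_mult_distrib)
  ultimately show ?thesis by simp
qed

lemma taylor_coeff_normalized_kernel:
  assumes "0 < t" "t < 1"
  shows "taylor_coeff (normalized_kernel (complex_of_real t)) = (\<lambda>n. complex_of_real (kernel_coeff t n))"
  using taylor_coeff_unique(2)[OF normalized_kernel_sums[OF assms]] .

lemma kernel_coeff_nonneg: "0 < t \<Longrightarrow> t < 1 \<Longrightarrow> 0 \<le> kernel_coeff t n"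
  using kernel_norm_sq_ge_1[of t] dirichlet_weight_ge_1[of n] by (simp add: kernel_coeff_def)

text \<open>A bound independent of \<open>n\<close> that tends to 0 as \<open>t\<close> tends to 1,
  because \<open>kernel_norm_sq\<close> tends to infinity.\<close>

lemma kernel_coeff_le:
  assumes "0 < t" "t < 1"
  shows "kernel_coeff t n \<le> 1 / sqrt (kernel_norm_sq t)"
proof -
  have "t ^ n / dirichlet_weight n \<le> 1"
    using assms dirichlet_weight_ge_1[of n] power_le_one[of t n] by (simp add: divide_le_eq)
  then show ?thesis
    using kernel_norm_sq_ge_1[OF assms] unfolding kernel_coeff_def by (intro divide_right_mono) auto
qed

text \<open>The weighted squares of the coefficients form the logarithmic series at
  \<open>t\<^sup>2\<close> with leading term 1, divided by its own sum
  \<open>kernel_norm_sq t\<close>.\<close>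

lemma normalized_kernel_in_dirichlet_space:
  assumes t: "0 < t" "t < 1"
  shows "normalized_kernel (complex_of_real t) \<in> dirichlet_space"
    and "dirichlet_norm (normalized_kernel (complex_of_real t)) \<le> 1"
proof -
  let ?k = "normalized_kernel (complex_of_real t)"
  have K: "kernel_norm_sq t \<ge> 1" using t by (rule kernel_norm_sq_ge_1)
  have t2: "\<bar>t\<^sup>2\<bar> < 1" using t by (simp add: abs_square_less_1)
  have "(\<lambda>n. - ((t\<^sup>2) ^ n) / real n) sums ln (1 - t\<^sup>2)"
    using ln_series'[of "- t\<^sup>2"] t2 by simp
  from sums_divide[OF sums_add[OF sums_single[of 0 "\<lambda>_. 1"] sums_minus[OF this]], of "kernel_norm_sq t"]
  have *: "(\<lambda>n. ((if n = 0 then 1 else 0) + (t\<^sup>2) ^ n / real n) / kernel_norm_sq t) sums 1"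
    using K by (simp add: kernel_norm_sq_def)
  have "dirichlet_weight n * (cmod (taylor_coeff ?k n))\<^sup>2
      = ((if n = 0 then 1 else 0) + (t\<^sup>2) ^ n / real n) / kernel_norm_sq t" for n
  proof -
    have "(cmod (taylor_coeff ?k n))\<^sup>2 = (t\<^sup>2) ^ n / (dirichlet_weight n)\<^sup>2 / kernel_norm_sq t"
      unfolding taylor_coeff_normalized_kernel[OF t] norm_of_real power2_abs kernel_coeff_def power_divide
      using K by (simp add: power_commutes flip: power_mult) (simp add: mult.commute)
    then show ?thesis by (simp add: dirichlet_weight_def power2_eq_square)
  qed
  with * have sums: "(\<lambda>n. dirichlet_weight n * (cmod (taylor_coeff ?k n))\<^sup>2) sums 1" by simp
  then have "summable (\<lambda>n. dirichlet_weight n * (cmod (taylor_coeff ?k n))\<^sup>2)" by (rule sums_summable)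
  then show D: "?k \<in> dirichlet_space"
    using dirichlet_space_iff[OF taylor_coeff_unique(1)[OF normalized_kernel_sums[OF t]]]
      summable_dirichlet_weight_iff by simp
  have "(dirichlet_norm ?k)\<^sup>2 = 1"
    using sums_unique2[OF dirichlet_norm_sums[OF D] sums] .
  then show "dirichlet_norm ?k \<le> 1"
    using dirichlet_norm_nonneg[OF D] by (simp add: power2_eq_1_iff)
qed

section \<open>Compactness implies convergence on the kernels\<close>

lemma cesaro_coeff_kernel_tendsto_0:
  "((\<lambda>t. cesaro_coeff \<eta> (normalized_kernel (complex_of_real t)) n) \<longlongrightarrow> 0) (at_left 1)"
proof (rule Lim_null_comparison)
  have "filterlim (\<lambda>t. sqrt (kernel_norm_sq t)) at_top (at_left 1)"
    by (rule filterlim_compose[OF sqrt_at_top kernel_norm_sq_at_left])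
  then have "((\<lambda>t. 1 / sqrt (kernel_norm_sq t)) \<longlongrightarrow> 0) (at_left 1)"
    by (rule tendsto_divide_0[OF tendsto_const filterlim_at_top_imp_at_infinity])
  from tendsto_mult[OF tendsto_const this, of "cmod (\<eta> n) * (real n + 1)"]
  show "((\<lambda>t. cmod (\<eta> n) * (real n + 1) * (1 / sqrt (kernel_norm_sq t))) \<longlongrightarrow> 0) (at_left 1)" by simp
  have "\<forall>\<^sub>F t in at_left (1::real). 0 < t \<and> t < 1"
    using eventually_at_left_real[of 0 1] by (auto elim: eventually_mono)
  then show "\<forall>\<^sub>F t in at_left 1. norm (cesaro_coeff \<eta> (normalized_kernel (complex_of_real t)) n)
      \<le> cmod (\<eta> n) * (real n + 1) * (1 / sqrt (kernel_norm_sq t))"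
  proof eventually_elim
    case (elim t)
    then have t: "0 < t" "t < 1" by auto
    \<comment> \<open>For fixed \<open>n\<close> only \<open>n + 1\<close> kernel coefficients
      enter, each under the uniform bound.\<close>
    have "cmod (\<Sum>k\<le>n. complex_of_real (kernel_coeff t k)) \<le> (\<Sum>k\<le>n. 1 / sqrt (kernel_norm_sq t))"
      using kernel_coeff_le[OF t] kernel_coeff_nonneg[OF t] by (intro sum_norm_le) simp
    then have "cmod (\<eta> n) * cmod (\<Sum>k\<le>n. complex_of_real (kernel_coeff t k))
        \<le> cmod (\<eta> n) * ((real n + 1) * (1 / sqrt (kernel_norm_sq t)))"
      by (intro mult_left_mono) (simp_all add: add.commute)
    then show ?case
      by (simp add: cesaro_coeff_def taylor_coeff_normalized_kernel[OF t] norm_mult mult_ac)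
  qed
qed

text \<open>If the norms of the images did not tend to 0, a subsequence would stay above some
  \<open>e > 0\<close> and, by compactness, converge in norm along a further subsequence. Its limit
  has zero coefficients, a contradiction.\<close>

lemma compact_imp_kernel_norm_tendsto_0:
  assumes C: "cesaro_compact \<eta>"
  shows "((\<lambda>t. cesaro_norm \<eta> (normalized_kernel (complex_of_real t))) \<longlongrightarrow> 0) (at_left (1::real))"
\<comment> \<open>The lower end 0 keeps the parameters in the open unit interval, where the facts on
  kernels hold.\<close>
proof (rule tendsto_at_left_sequentially[of 0])
  fix S :: "nat \<Rightarrow> real"
  assume S: "\<And>n. S n < 1" "\<And>n. 0 < S n" "S \<longlonglongrightarrow> 1"
  define K where "K n = normalized_kernel (complex_of_real (S n))" for n
  have KD: "K n \<in> dirichlet_space" and KB: "dirichlet_norm (K n) \<le> 1" for n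
    using normalized_kernel_in_dirichlet_space[of "S n"] S by (auto simp: K_def)
  have wd: "cesaro_well_defined \<eta> f" and CD: "cesaro \<eta> f \<in> dirichlet_space"
    if "f \<in> dirichlet_space" for f
    using C that by (auto simp: cesaro_compact_def dirichlet_compact_def dirichlet_linear_def)
  have hol: "f holomorphic_on ball 0 1" if "f \<in> dirichlet_space" for f
    using that by (simp add: dirichlet_space_def)
  have "filterlim S (at_left 1) sequentially"
    unfolding filterlim_at using S(3,1) S(1)[THEN less_imp_neq] by auto
  from filterlim_compose[OF cesaro_coeff_kernel_tendsto_0 this]
  have coeff0: "(\<lambda>n. cesaro_coeff \<eta> (K n) k) \<longlonglongrightarrow> 0" for k
    by (simp add: K_def)
  define x where "x n = dirichlet_norm (cesaro \<eta> (K n))" for n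
  have x0: "0 \<le> x n" for n unfolding x_def by (intro dirichlet_norm_nonneg CD KD)
  have "x \<longlonglongrightarrow> 0"
  proof (rule ccontr)
    assume "\<not> x \<longlonglongrightarrow> 0"
    then obtain e where e: "e > 0" "\<not> (\<forall>\<^sub>F n in sequentially. x n < e)"
      using x0 by (auto simp: tendsto_iff)
    then have "infinite {n. e \<le> x n}"
      by (simp add: infinite_nat_iff_unbounded_le eventually_sequentially not_less)
    then obtain s :: "nat \<Rightarrow> nat" where s: "strict_mono s" "\<And>n. e \<le> x (s n)"
      using infinite_enumerate[of "{n. e \<le> x n}"] by auto
    have "\<forall>n. K (s n) \<in> dirichlet_space \<and> dirichlet_norm (K (s n)) \<le> 1"
      using KD KB by auto
    then obtain g r where g: "g \<in> dirichlet_space" and r: "strict_mono r"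
      and lim: "(\<lambda>n. dirichlet_norm (\<lambda>z. cesaro \<eta> (K (s (r n))) z - g z)) \<longlonglongrightarrow> 0"
      using C unfolding cesaro_compact_def dirichlet_compact_def by meson
    let ?h = "\<lambda>n z. cesaro \<eta> (K (s (r n))) z - g z"
    have hD: "?h n \<in> dirichlet_space" for n
      using dirichlet_space_lincomb(1)[OF CD[OF KD[of "s (r n)"]] g, where a=1 and b="-1"] by simp
    have h_coeff: "taylor_coeff (?h n) = (\<lambda>k. cesaro_coeff \<eta> (K (s (r n))) k - taylor_coeff g k)" for n
      using taylor_coeff_lincomb[OF hol[OF CD[OF KD[of "s (r n)"]]] hol[OF g], where a=1 and b="-1"]
        taylor_coeff_cesaro[OF wd[OF KD[of "s (r n)"]]] by simp
    have "strict_mono (s \<circ> r)" using s r by (simp add: strict_mono_o)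
    \<comment> \<open>Norm convergence sends the coefficients of \<open>?h n\<close> to 0, while
      those of the images tend to 0 as well.\<close>
    have g0: "taylor_coeff g k = 0" for k
    proof -
      have "(\<lambda>n. taylor_coeff (?h n) k) \<longlonglongrightarrow> 0"
        by (rule Lim_null_comparison[OF _ lim]) (use taylor_coeff_norm_le[OF hD] in auto)
      moreover have "(\<lambda>n. taylor_coeff (?h n) k) \<longlonglongrightarrow> 0 - taylor_coeff g k"
        unfolding h_coeff
        using LIMSEQ_subseq_LIMSEQ[OF coeff0[of k] \<open>strict_mono (s \<circ> r)\<close>]
        by (intro tendsto_diff tendsto_const) (simp add: o_def)
      ultimately show ?thesis using LIMSEQ_unique by fastforce
    qed
    have "dirichlet_norm (?h n) = x (s (r n))" for n
      unfolding x_def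
      by (rule dirichlet_norm_eqI[OF hD CD[OF KD]])
         (simp add: h_coeff g0 taylor_coeff_cesaro[OF wd[OF KD]])
    with lim have "(\<lambda>n. x (s (r n))) \<longlonglongrightarrow> 0" by simp
    then have "e \<le> 0" by (rule tendsto_lowerbound) (use s in auto)
    with e show False by simp
  qed
  then have "(\<lambda>n. ennreal (x n)) \<longlonglongrightarrow> ennreal 0" by (rule tendsto_ennrealI)
  then show "(\<lambda>n. cesaro_norm \<eta> (normalized_kernel (complex_of_real (S n)))) \<longlonglongrightarrow> 0"
    using wd[OF KD] CD[OF KD] by (simp add: cesaro_norm_def x_def K_def)
qed simp

section \<open>From the kernels to the tail condition\<close>

lemma kernel_partial_sum_ge:
  fixes m n :: nat
  defines "t \<equiv> 1 - 1 / (2 * (real m + 2))"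
  assumes "m \<le> n"
  shows "(1 + ln (real m + 2)) / 32
    \<le> (cmod (\<Sum>k\<le>n. taylor_coeff (normalized_kernel (complex_of_real t)) k))\<^sup>2"
proof -
  define L where "L = 1 + ln (real m + 2)"
  have L: "L > 0" by (simp add: L_def add_pos_pos)
  have t: "0 < t" "t < 1" by (auto simp: t_def field_simps)
  have K1: "kernel_norm_sq t \<ge> 1" using t by (rule kernel_norm_sq_ge_1)
  \<comment> \<open>The choice of \<open>t\<close> is made for this: by Bernoulli's inequality, no
    power up to \<open>m\<close> falls below 1/2, so the first \<open>m + 1\<close> kernel
    coefficients stay comparable with the inverse weights.\<close>
  have tm: "1 / 2 \<le> t ^ m"
  proof -
    have "1 / 2 \<le> 1 + real m * (- (1 / (2 * (real m + 2))))" by (simp add: field_simps)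
    also have "\<dots> \<le> (1 + - (1 / (2 * (real m + 2)))) ^ m"
      by (rule Bernoulli_inequality) (simp add: field_simps)
    finally show ?thesis by (simp add: t_def)
  qed
  \<comment> \<open>Conversely \<open>1 - t\<close> is not too small, so the norm of the kernel
    grows at most logarithmically in \<open>m\<close>.\<close>
  have KL: "kernel_norm_sq t \<le> 2 * L"
  proof -
    have "1 / (2 * (real m + 2)) = 1 - t" by (simp add: t_def)
    also have "\<dots> \<le> 1 - t\<^sup>2" using t by (simp add: power2_eq_square mult_le_cancel_left1)
    finally have "ln (1 / (2 * (real m + 2))) \<le> ln (1 - t\<^sup>2)" by (intro ln_mono) auto
    also have "ln (1 / (2 * (real m + 2))) = - ln (2 * (real m + 2))"
      by (subst ln_div) auto
    also have "ln (2 * (real m + 2)) = ln 2 + ln (real m + 2)"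
      by (rule ln_mult_pos) auto
    finally have "- (ln 2 + ln (real m + 2)) \<le> ln (1 - t\<^sup>2)" .
    moreover have "ln 2 \<le> (1 :: real)" using ln_le_minus_one[of 2] by simp
    moreover have "0 \<le> ln (real m + 2)" by simp
    ultimately have "1 - ln (1 - t\<^sup>2) \<le> 2 * (1 + ln (real m + 2))" by argo
    then show ?thesis by (simp only: kernel_norm_sq_def L_def)
  qed
  have V: "L / 2 \<le> dirichlet_weight_sum m" using dirichlet_weight_sum_ge[of m] by (simp add: L_def)
  \<comment> \<open>The numerator has order \<open>L\<close> and the kernel norm at most order
    \<open>sqrt L\<close>; squaring the left side gives \<open>L / 32\<close>.\<close>
  have "1 / 2 * (L / 2) / sqrt (2 * L) \<le> t ^ m * dirichlet_weight_sum m / sqrt (kernel_norm_sq t)"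
    using tm V L KL K1 by (intro frac_le mult_mono) auto
  also have "\<dots> = (\<Sum>k\<le>m. t ^ m / dirichlet_weight k / sqrt (kernel_norm_sq t))"
    by (simp add: dirichlet_weight_sum_def sum_distrib_left sum_divide_distrib)
  also have "\<dots> \<le> (\<Sum>k\<le>m. kernel_coeff t k)"
    unfolding kernel_coeff_def using t K1 dirichlet_weight_ge_1
    by (intro sum_mono divide_right_mono power_decreasing) (auto intro: order_trans[OF zero_le_one])
  also have "\<dots> \<le> (\<Sum>k\<le>n. kernel_coeff t k)"
    using assms(2) kernel_coeff_nonneg[OF t] by (intro sum_mono2) auto
  finally have "(1 / 2 * (L / 2) / sqrt (2 * L))\<^sup>2 \<le> (\<Sum>k\<le>n. kernel_coeff t k)\<^sup>2"
    using L by (intro power_mono) auto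
  moreover have "(1 / 2 * (L / 2) / sqrt (2 * L))\<^sup>2 = L / 32"
    using L by (simp add: power_divide power2_eq_square)
  moreover have "cmod (\<Sum>k\<le>n. taylor_coeff (normalized_kernel (complex_of_real t)) k) = \<bar>\<Sum>k\<le>n. kernel_coeff t k\<bar>"
    unfolding taylor_coeff_normalized_kernel[OF t] of_real_sum[symmetric] by (rule norm_of_real)
  ultimately show ?thesis by (simp add: L_def)
qed

text \<open>For \<open>n \<ge> m\<close> the squared partial sum of the kernel coefficients is at
  least \<open>L / 32\<close>, so \<open>L / 32\<close> times the tail from \<open>m\<close> is at
  most the squared norm of the image.\<close>

lemma kernel_norm_tendsto_0_imp_tail_condition:
  assumes lim: "((\<lambda>t. cesaro_norm \<eta> (normalized_kernel (complex_of_real t))) \<longlongrightarrow> 0) (at_left (1::real))"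
  shows "tail_condition \<eta>"
proof -
  define t where "t m = 1 - 1 / (2 * (real m + 2))" for m
  define K where "K m = normalized_kernel (complex_of_real (t m))" for m
  define x where "x m = dirichlet_norm (cesaro \<eta> (K m))" for m
  have t1: "t m < 1" for m by (simp add: t_def)
  have "t \<longlonglongrightarrow> 1" unfolding t_def by real_asymp
  then have "filterlim t (at_left 1) sequentially"
    using t1 by (auto simp: filterlim_at less_imp_neq)
  from filterlim_compose[OF lim this]
  have limK: "(\<lambda>m. cesaro_norm \<eta> (K m)) \<longlonglongrightarrow> 0" by (simp add: K_def)
  \<comment> \<open>Finiteness encodes that the image is well defined and lies in the space, so real
    norms may be used from some index on.\<close>
  have fin: "\<forall>\<^sub>F m in sequentially. cesaro_norm \<eta> (K m) < \<infinity>"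
    by (rule order_tendstoD(2)[OF limK]) simp
  have est: "summable (cesaro_weight \<eta>) \<and> cesaro_tail \<eta> m * ln (real m + 2) \<le> 32 * (x m)\<^sup>2"
    and norm_x: "cesaro_norm \<eta> (K m) = ennreal (x m)" and x0: "0 \<le> x m"
    if "cesaro_norm \<eta> (K m) < \<infinity>" for m
  proof -
    have wd: "cesaro_well_defined \<eta> (K m)" and D: "cesaro \<eta> (K m) \<in> dirichlet_space"
      using that by (auto simp: cesaro_norm_def split: if_splits)
    show "cesaro_norm \<eta> (K m) = ennreal (x m)" using wd D by (simp add: cesaro_norm_def x_def)
    show "0 \<le> x m" unfolding x_def using D by (rule dirichlet_norm_nonneg)
    define L where "L = 1 + ln (real m + 2)"
    have L: "L > 0" by (simp add: L_def add_pos_pos)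
    define c where "c n = cesaro_weight \<eta> n * (cmod (\<Sum>k\<le>n. taylor_coeff (K m) k))\<^sup>2" for n
    have c0: "0 \<le> c n" for n by (simp add: c_def cesaro_weight_nonneg)
    have c: "c sums (x m)\<^sup>2"
      using dirichlet_norm_sums[OF D]
      by (simp add: taylor_coeff_cesaro[OF wd] weighted_norm_cesaro_coeff x_def c_def[abs_def])
    have le: "cesaro_weight \<eta> n * (L / 32) \<le> c n" if "m \<le> n" for n
      unfolding c_def K_def t_def L_def
      by (intro mult_left_mono kernel_partial_sum_ge that cesaro_weight_nonneg)
    have "summable (\<lambda>n. cesaro_weight \<eta> n * (L / 32))"
      by (rule summable_comparison_test'[OF sums_summable[OF c], of m])
         (use le L cesaro_weight_nonneg[of \<eta>] in \<open>simp add: abs_mult\<close>)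
    then have "summable (\<lambda>n. cesaro_weight \<eta> n * (L / 32) * (32 / L))" by (rule summable_mult2)
    moreover have "(\<lambda>n. cesaro_weight \<eta> n * (L / 32) * (32 / L)) = cesaro_weight \<eta>"
      using L by (intro ext) (simp only: mult.assoc, simp)
    ultimately have sum: "summable (cesaro_weight \<eta>)" by (simp only:)
    have "cesaro_tail \<eta> m * (L / 32) = (\<Sum>n. cesaro_weight \<eta> (n + m) * (L / 32))"
      unfolding cesaro_tail_def by (rule suminf_mult2[OF summable_ignore_initial_segment[OF sum]])
    also have "\<dots> \<le> (\<Sum>n. c (n + m))"
      by (rule suminf_le[OF le summable_mult2[OF summable_ignore_initial_segment[OF sum]]
            summable_ignore_initial_segment[OF sums_summable[OF c]]]) simp
    also have "\<dots> \<le> suminf c"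
      using suminf_split_initial_segment[OF sums_summable[OF c], of m] sum_nonneg[of "{..<m}" c, OF c0]
      by linarith
    also have "\<dots> = (x m)\<^sup>2" using c by (simp add: sums_iff)
    finally have "cesaro_tail \<eta> m * L \<le> 32 * (x m)\<^sup>2" by simp
    moreover have "cesaro_tail \<eta> m * ln (real m + 2) \<le> cesaro_tail \<eta> m * L"
      by (intro mult_left_mono cesaro_tail_nonneg sum) (simp add: L_def)
    ultimately show "summable (cesaro_weight \<eta>) \<and> cesaro_tail \<eta> m * ln (real m + 2) \<le> 32 * (x m)\<^sup>2"
      using sum by (meson order_trans)
  qed
  \<comment> \<open>One kernel whose image has finite norm is enough.\<close>
  have sum: "summable (cesaro_weight \<eta>)"
  proof -
    obtain m where "cesaro_norm \<eta> (K m) < \<infinity>"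
      using eventually_happens'[OF sequentially_bot fin] by blast
    then show ?thesis using est by blast
  qed
  have "\<forall>\<^sub>F m in sequentially. cesaro_norm \<eta> (K m) = ennreal (x m)"
    using fin by eventually_elim (rule norm_x)
  from Lim_transform_eventually[OF limK this] have "(\<lambda>m. ennreal (x m)) \<longlonglongrightarrow> ennreal 0" by simp
  moreover have "\<forall>\<^sub>F m in sequentially. 0 \<le> x m"
    using fin by eventually_elim (rule x0)
  ultimately have "x \<longlonglongrightarrow> 0" by (intro tendsto_ennrealD) simp_all
  then have "(\<lambda>m. 32 * (x m)\<^sup>2) \<longlonglongrightarrow> 32 * 0\<^sup>2" by (intro tendsto_intros)
  then have lim32: "(\<lambda>m. 32 * (x m)\<^sup>2) \<longlonglongrightarrow> 0" by simp
  have "(\<lambda>m. cesaro_tail \<eta> m * ln (real m + 2)) \<longlonglongrightarrow> 0"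
  proof (rule tendsto_sandwich[OF _ _ tendsto_const lim32])
    show "\<forall>\<^sub>F m in sequentially. 0 \<le> cesaro_tail \<eta> m * ln (real m + 2)"
      by (intro always_eventually allI mult_nonneg_nonneg cesaro_tail_nonneg sum) simp
    show "\<forall>\<^sub>F m in sequentially. cesaro_tail \<eta> m * ln (real m + 2) \<le> 32 * (x m)\<^sup>2"
      using fin by eventually_elim (use est in blast)
  qed
  with sum show ?thesis by (simp add: tail_condition_iff)
qed

text \<open>The three implications close the cycle from (iii) to (i) to (ii) and back to
  (iii).\<close>

theorem theorem4p2:
  fixes \<eta> :: "nat \<Rightarrow> complex"
  shows "(cesaro_compact \<eta> \<longleftrightarrow>
            ((\<lambda>t. cesaro_norm \<eta> (normalized_kernel (complex_of_real t))) \<longlongrightarrow> 0) (at_left (1::real)))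
       \<and> (((\<lambda>t. cesaro_norm \<eta> (normalized_kernel (complex_of_real t))) \<longlongrightarrow> 0) (at_left (1::real))
            \<longleftrightarrow> tail_condition \<eta>)"
  using tail_condition_imp_compact compact_imp_kernel_norm_tendsto_0
    kernel_norm_tendsto_0_imp_tail_condition by blast

end
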